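(* Assume $\kappa=\kappa^{<\kappa}$. For every point $x$ of $S_\kappa$, the Stone–Čech remainder $(S_\kappa\setminus\{x\})^*$ is a $\kappa^+$-Parovičenko space of weight $2^\kappa$.
   Context: A space is zero-dimensional if it has a base of clopen sets. For a zero-dimensional space $X$ and an open $U\subseteq X$, the ($X$-)type $\tau(U)$ is the least cardinal $\tau$ such that $U$ is a union of $\tau$ many clopen subsets of $X$. A zero-dimensional space is an $F_\lambda$-space if every open subset of type less than $\lambda$ is $C^*$-embedded (every bounded continuous real-valued function on it extends continuously to the whole space). A space is a $G_\lambda$-space if every non-empty intersection of fewer than $\lambda$ open sets has non-empty interior. A $\lambda$-Parovičenko space is a compact Hausdorff zero-dimensional $F_\lambda$- and $G_\lambda$-space without isolated points (no weight restriction is imposed). If $\kappa=\kappa^{<\kappa}$ there is, up to homeomorphism, a unique $\kappa$-Parovičenko space of weight $\kappa$; it is denoted $S_\kappa$. For a Tychonoff space $X$, $X^*=\beta X\setminus X$ denotes its Stone–Čech remainder. *)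

theory Defs
  imports "HOL-Analysis.Analysis" "HOL-Library.Equipollence" "HOL-Library.FuncSet"
begin

definition clopenin :: "'a topology \<Rightarrow> 'a set \<Rightarrow> bool" where
  "clopenin X C \<longleftrightarrow> openin X C \<and> closedin X C"

definition zero_dim :: "'a topology \<Rightarrow> bool" where
  "zero_dim X \<longleftrightarrow> (\<forall>U x. openin X U \<and> x \<in> U \<longrightarrow> (\<exists>C. clopenin X C \<and> x \<in> C \<and> C \<subseteq> U))"

definition type_less :: "'a topology \<Rightarrow> 'a set \<Rightarrow> 'l set \<Rightarrow> bool" where
  "type_less X U L \<longleftrightarrow> (\<exists>\<C>. (\<forall>C\<in>\<C>. clopenin X C) \<and> \<Union>\<C> = U \<and> \<C> \<prec> L)"

definition Cstar_embedded :: "'a topology \<Rightarrow> 'a set \<Rightarrow> bool" where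
  "Cstar_embedded X U \<longleftrightarrow>
     (\<forall>f. continuous_map (subtopology X U) euclideanreal f \<and> (\<exists>M. \<forall>x\<in>U. \<bar>f x\<bar> \<le> M)
        \<longrightarrow> (\<exists>g. continuous_map X euclideanreal g \<and> (\<forall>x\<in>U. g x = f x)))"

definition F_space :: "'l set \<Rightarrow> 'a topology \<Rightarrow> bool" where
  "F_space L X \<longleftrightarrow> zero_dim X \<and>
     (\<forall>U. openin X U \<and> type_less X U L \<longrightarrow> Cstar_embedded X U)"

definition G_space :: "'l set \<Rightarrow> 'a topology \<Rightarrow> bool" where
  "G_space L X \<longleftrightarrow>
     (\<forall>\<U>. (\<forall>U\<in>\<U>. openin X U) \<and> \<U> \<prec> L \<and> topspace X \<inter> \<Inter>\<U> \<noteq> {}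
        \<longrightarrow> X interior_of (topspace X \<inter> \<Inter>\<U>) \<noteq> {})"

definition isolated_point :: "'a topology \<Rightarrow> 'a \<Rightarrow> bool" where
  "isolated_point X x \<longleftrightarrow> x \<in> topspace X \<and> openin X {x}"

definition Parovicenko :: "'l set \<Rightarrow> 'a topology \<Rightarrow> bool" where
  "Parovicenko L X \<longleftrightarrow> compact_space X \<and> Hausdorff_space X \<and> zero_dim X \<and>
     F_space L X \<and> G_space L X \<and> (\<forall>x. \<not> isolated_point X x)"

definition is_base :: "'a topology \<Rightarrow> 'a set set \<Rightarrow> bool" where
  "is_base X \<B> \<longleftrightarrow> (\<forall>B\<in>\<B>. openin X B) \<and>
     (\<forall>U. openin X U \<longrightarrow> (\<exists>\<C>\<subseteq>\<B>. \<Union>\<C> = U))"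

definition has_weight :: "'a topology \<Rightarrow> 'k set \<Rightarrow> bool" where
  "has_weight X K \<longleftrightarrow> (\<exists>\<B>. is_base X \<B> \<and> \<B> \<approx> K) \<and> (\<forall>\<B>. is_base X \<B> \<longrightarrow> K \<lesssim> \<B>)"

definition kappa_lt_kappa_eq :: "'k set \<Rightarrow> bool" where
  "kappa_lt_kappa_eq K \<longleftrightarrow> (\<Union>A\<in>{A. A \<subseteq> K \<and> A \<prec> K}. A \<rightarrow>\<^sub>E K) \<approx> K"

definition stone_cech :: "'a topology \<Rightarrow> 'b topology \<Rightarrow> ('a \<Rightarrow> 'b) \<Rightarrow> bool" where
  "stone_cech Y B e \<longleftrightarrow> compact_space B \<and> Hausdorff_space B \<and> embedding_map Y B e \<and>
     B closure_of (e ` topspace Y) = topspace B \<and>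
     (\<forall>f. continuous_map Y euclideanreal f \<and> (\<exists>M. \<forall>y\<in>topspace Y. \<bar>f y\<bar> \<le> M)
        \<longrightarrow> (\<exists>g. continuous_map B euclideanreal g \<and> (\<forall>y\<in>topspace Y. g (e y) = f y)))"

definition remainder :: "'a topology \<Rightarrow> 'b topology \<Rightarrow> ('a \<Rightarrow> 'b) \<Rightarrow> 'b topology" where
  "remainder Y B e = subtopology B (topspace B - e ` topspace Y)"

end

(*
  Let Y be X without the point x. Disjoint open sets of type < kappa are separated by clopen sets
  of X, because X is an F_kappa-space. Recursion along a cover of Y by kappa many compact clopen
  sets C a extends this to disjoint open subsets of Y that have type < kappa on every C a. Hence
  Y is strongly zero-dimensional, and the clopen algebra of the remainder is the algebra
  of clopen sets of Y modulo those that are "far" from x, that is, relatively compact in Y.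

  The point x need not be a P-point, so a union U a of fewer than kappa many C b may accumulate
  at x. But two disjoint open sets of type < kappa never both accumulate at x. So of two
  disjoint clopen subsets of Y at least one is "tame": it meets every U a in a set far from x, and
  relative to it x behaves like a P_kappa-point. The constructions of length kappa
  (pseudointersections of centred families, separation of orthogonal families) take place
  inside tame sets.
*)
theory Submission
  imports Defs
begin

section \<open>Regular cardinals\<close>

unbundle cardinal_syntax

text \<open>The obstacle to recursions of length kappa in \<open>Y\<close> is the point
  \<open>x\<close>. Given fewer than kappa clopen sets of \<open>Y\<close> whose finite
  intersections are not far, compactness of \<open>X\<close> produces a point in all their closures,
  but this point may be \<open>x\<close> itself. That such sets have a common point in
  \<open>Y\<close> is the dual form of \<open>finite_subcover_small\<close>. At a common point in
  \<open>Y\<close>, the \<open>G\<close> property of \<open>X\<close> yields a non-empty clopen set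
  in the intersection, and iterating this produces kappa many disjoint clopen sets that leave every
  compact subset of \<open>Y\<close> (\<open>sparse\<close>). Splitting, pseudointersections and the
  2^kappa many clopen sets of the remainder are all obtained by selecting cofinal subsequences of
  such a sequence. On the remainder, the \<open>G\<close> property at kappa^+ follows from
  pseudointersections of centred families of size kappa, the \<open>F\<close> property at kappa^+
  from separation of orthogonal families of size kappa.\<close>

lemma lesspoll_iff_card_of_ordLess: "A \<prec> B \<longleftrightarrow> |A| <o |B|"
proof -
  have "A \<prec> B \<longleftrightarrow> \<not> B \<lesssim> A"
    unfolding lesspoll_def 
    by (metis card_of_Well_order card_of_ordLeq eqpoll_sym eqpoll_imp_lepoll lepoll_antisym lepoll_def ordLeq_total)
  then show ?thesis
    using not_ordLeq_iff_ordLess[OF card_of_Well_order card_of_Well_order, of B A]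
    by (simp add: lepoll_def card_of_ordLeq)
qed

lemma lepoll_iff_card_of_ordLeq: "A \<lesssim> B \<longleftrightarrow> |A| \<le>o |B|"
  by (simp add: card_of_ordLeq lepoll_def)

text \<open>The successor cardinal kappa^+ is represented by the set
  \<open>Field (cardSuc (card_of K))\<close>; the families smaller than it are those that can be
  indexed by \<open>K\<close>.\<close>

lemma lesspoll_Field_cardSuc_iff: "A \<prec> Field (cardSuc (card_of K)) \<longleftrightarrow> A \<lesssim> K"
proof -
  have "cardSuc (card_of K) =o |Field (cardSuc (card_of K))|"
    by (simp add: cardSuc_Card_order card_of_Card_order card_of_Field_ordIso ordIso_symmetric)
  then have "A \<prec> Field (cardSuc (card_of K)) \<longleftrightarrow> |A| <o cardSuc (card_of K)"
    unfolding lesspoll_iff_card_of_ordLess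
    using ordIso_symmetric ordLess_ordIso_trans by blast
  then show ?thesis
    by (simp add: cardSuc_ordLeq_ordLess card_of_Card_order lepoll_iff_card_of_ordLeq)
qed

text \<open>The default \<open>d\<close> fills the indices that no element of \<open>A\<close> uses
  (all of them if \<open>A\<close> is empty). In applications it is a neutral element: the empty set
  for unions, the whole space for intersections.\<close>

lemma lepoll_enumeration:
  assumes "A \<lesssim> K"
  obtains f where "A \<subseteq> f ` K" "f ` K \<subseteq> insert d A"
proof -
  obtain g where g: "inj_on g A" "g ` A \<subseteq> K"
    using assms unfolding lepoll_def by blast
  define f where "f b = (if b \<in> g ` A then inv_into A g b else d)" for b
  have "f (g y) = y" if "y \<in> A" for y
    using that g by (simp add: f_def)
  then have "A \<subseteq> f ` K"
    using g by (metis image_eqI image_subset_iff subsetI)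
  moreover have "f ` K \<subseteq> insert d A"
    by (auto simp: f_def inv_into_into)
  ultimately show thesis
    by (rule that)
qed

lemma finite_subsets_lepoll:
  assumes "infinite \<B>"
  shows "{\<F>. \<F> \<subseteq> \<B> \<and> finite \<F>} \<lesssim> \<B>"
proof -
  have "\<B> \<times> \<B> \<lesssim> \<B>"
    using assms by (simp add: lepoll_iff_card_of_ordLeq card_of_Times_same_infinite ordIso_imp_ordLeq)
  have "{\<F>. \<F> \<subseteq> \<B> \<and> finite \<F> \<and> card \<F> = n} \<lesssim> \<B>" for n
  proof (induction n)
    case 0
    have "{\<F>. \<F> \<subseteq> \<B> \<and> finite \<F> \<and> card \<F> = 0} = {{}}"
      by auto
    then show ?case
      using assms finite_lepoll_infinite by (metis finite.emptyI finite_insert)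
  next
    case (Suc n)
    let ?S = "{\<F>. \<F> \<subseteq> \<B> \<and> finite \<F> \<and> card \<F> = n}"
    have "{\<F>. \<F> \<subseteq> \<B> \<and> finite \<F> \<and> card \<F> = Suc n} \<subseteq> (\<lambda>(b, \<F>). insert b \<F>) ` (\<B> \<times> ?S)"
    proof
      fix \<F> assume "\<F> \<in> {\<F>. \<F> \<subseteq> \<B> \<and> finite \<F> \<and> card \<F> = Suc n}"
      moreover from this obtain b \<G> where "\<F> = insert b \<G>" "b \<notin> \<G>" "card \<G> = n"
        by (auto simp: card_Suc_eq)
      ultimately show "\<F> \<in> (\<lambda>(b, \<F>). insert b \<F>) ` (\<B> \<times> ?S)"
        by (intro image_eqI[of _ _ "(b, \<G>)"]) auto
    qed
    then have "{\<F>. \<F> \<subseteq> \<B> \<and> finite \<F> \<and> card \<F> = Suc n} \<lesssim> \<B> \<times> ?S"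
      by (rule subset_image_lepoll)
    also have "\<B> \<times> ?S \<lesssim> \<B> \<times> \<B>"
      by (rule times_lepoll_mono[OF lepoll_refl Suc])
    also note \<open>\<B> \<times> \<B> \<lesssim> \<B>\<close>
    finally show ?case .
  qed
  moreover have "|UNIV :: nat set| \<le>o |\<B>|"
    using assms by (simp add: infinite_le_lepoll lepoll_iff_card_of_ordLeq)
  ultimately have "|\<Union>n. {\<F>. \<F> \<subseteq> \<B> \<and> finite \<F> \<and> card \<F> = n}| \<le>o |\<B>|"
    using card_of_UNION_ordLeq_infinite[OF assms, of UNIV "\<lambda>n. {\<F>. \<F> \<subseteq> \<B> \<and> finite \<F> \<and> card \<F> = n}"]
    by (simp add: lepoll_iff_card_of_ordLeq)
  moreover have "(\<Union>n. {\<F>. \<F> \<subseteq> \<B> \<and> finite \<F> \<and> card \<F> = n}) = {\<F>. \<F> \<subseteq> \<B> \<and> finite \<F>}"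
    by auto
  ultimately show ?thesis
    by (simp add: lepoll_iff_card_of_ordLeq)
qed

lemma lepoll_finite_subsets:
  assumes "A \<lesssim> {\<F>. \<F> \<subseteq> \<B> \<and> finite \<F>}" "infinite A"
  shows "A \<lesssim> \<B>"
proof -
  have "infinite \<B>"
  proof
    assume "finite \<B>"
    then have "finite {\<F>. \<F> \<subseteq> \<B> \<and> finite \<F>}"
      by simp
    then show False
      using assms lepoll_iff by (metis finite_imageI finite_subset)
  qed
  then show ?thesis
    using assms(1) lepoll_trans finite_subsets_lepoll by blast
qed

lemma underS_card_of_cases:
  "\<lbrakk>a \<in> K; b \<in> K\<rbrakk> \<Longrightarrow> a = b \<or> a \<in> underS (card_of K) b \<or> b \<in> underS (card_of K) a"
  using card_of_well_order_on[of K]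
  unfolding well_order_on_def linear_order_on_def total_on_def underS_def by blast

text \<open>\<open>card_of K\<close> is a well-order of least possible type on \<open>K\<close>, so
  its proper initial segments are smaller than \<open>K\<close>. Regularity is expressed as strict
  boundedness of small subsets, the form in which recursions use it.\<close>

locale regular_cardinal =
  fixes K :: "'k set"
  assumes infinite_K: "infinite K"
    and small_bounded: "\<And>A. A \<subseteq> K \<Longrightarrow> A \<prec> K \<Longrightarrow> \<exists>b\<in>K. A \<subseteq> underS (card_of K) b"
begin

abbreviation before :: "'k \<Rightarrow> 'k set" where
  "before a \<equiv> underS (card_of K) a"

lemma before_subset: "before a \<subseteq> K"
  using Field_card_of[of K] by (auto simp: underS_def Field_def)

lemma before_in: "b \<in> before a \<Longrightarrow> b \<in> K"
  using before_subset by blast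

lemma before_small: "before a \<prec> K"
proof (cases "a \<in> K")
  case True
  then show ?thesis
    using card_of_underS[OF card_of_Card_order, of a K]
    by (simp add: Field_card_of lesspoll_iff_card_of_ordLess)
next
  case False
  then have "before a = {}"
    by (simp add: Field_card_of underS_empty)
  then show ?thesis
    by (simp add: infinite_K finite_lesspoll_infinite)
qed

lemma before_irrefl: "a \<notin> before a"
  by (simp add: underS_def)

lemma before_cases: "\<lbrakk>a \<in> K; b \<in> K\<rbrakk> \<Longrightarrow> a = b \<or> a \<in> before b \<or> b \<in> before a"
  by (rule underS_card_of_cases)

lemma before_trans: "\<lbrakk>a \<in> before b; b \<in> before c\<rbrakk> \<Longrightarrow> a \<in> before c"
  using card_of_well_order_on[of K]
  unfolding well_order_on_def linear_order_on_def partial_order_on_def preorder_on_def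
    underS_def trans_def antisym_def by blast

lemma before_asym: "a \<in> before b \<Longrightarrow> b \<notin> before a"
  using before_irrefl before_trans by blast

lemma wf_before: "wf {(a, b). a \<in> before b}"
proof -
  have "wf ( |K| - Id)"
    using card_of_well_order_on[of K] by (simp add: well_order_on_def)
  then show ?thesis
    by (rule wf_subset) (auto simp: underS_def)
qed

lemma regularCard_K: "regularCard |K|"
  unfolding regularCard_def
proof (intro allI impI, elim conjE)
  fix A assume A: "A \<subseteq> Field |K|" and cof: "cofinal A |K|"
  show "|A| =o |K|"
  proof (rule ccontr)
    assume "\<not> |A| =o |K|"
    moreover have "|A| \<le>o |K|"
      using A by (simp add: Field_card_of card_of_mono1)
    ultimately have "A \<prec> K"
      by (simp add: lesspoll_iff_card_of_ordLess ordLeq_iff_ordLess_or_ordIso)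
    then obtain b where b: "b \<in> K" "A \<subseteq> before b"
      using small_bounded[of A] A by (auto simp: Field_card_of)
    then obtain c where c: "c \<in> A" "b \<noteq> c" "(b, c) \<in> |K|"
      using cof unfolding cofinal_def by (metis Field_card_of)
    then have "b \<in> before c"
      by (simp add: underS_def)
    then show False
      using b c before_asym by blast
  qed
qed

lemma small_UN: "\<lbrakk>I \<prec> K; \<And>i. i \<in> I \<Longrightarrow> A i \<prec> K\<rbrakk> \<Longrightarrow> (\<Union>i\<in>I. A i) \<prec> K"
  unfolding lesspoll_iff_card_of_ordLess
  by (rule regularCard_UNION_bound[OF _ regularCard_K])
    (simp_all add: infinite_K cinfinite_def Field_card_of card_of_card_order_on)

lemma finite_small: "finite A \<Longrightarrow> A \<prec> K"
  by (simp add: finite_lesspoll_infinite infinite_K)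

lemma small_image: "A \<prec> K \<Longrightarrow> f ` A \<prec> K"
  using image_lepoll lesspoll_trans1 by blast

lemma small_subset: "\<lbrakk>A \<prec> K; B \<subseteq> A\<rbrakk> \<Longrightarrow> B \<prec> K"
  using subset_imp_lepoll lesspoll_trans1 by blast

lemma small_Un: "\<lbrakk>A \<prec> K; B \<prec> K\<rbrakk> \<Longrightarrow> A \<union> B \<prec> K"
  using small_UN[of "{True, False}" "\<lambda>b. if b then A else B"] finite_small[of "{True, False}"]
  by (simp add: Un_commute)

lemma small_Times: "\<lbrakk>A \<prec> K; B \<prec> K\<rbrakk> \<Longrightarrow> A \<times> B \<prec> K"
proof -
  assume "A \<prec> K" "B \<prec> K"
  moreover have "A \<times> B = (\<Union>a\<in>A. Pair a ` B)"
    by auto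
  ultimately show ?thesis
    using small_UN small_image by metis
qed

lemma small_insert_before: "insert a (before a) \<prec> K"
  using small_Un[OF finite_small[of "{a}"] before_small] by simp

lemma exists_above: "a \<in> K \<Longrightarrow> \<exists>b\<in>K. a \<in> before b"
  using small_bounded[of "{a}"] finite_small[of "{a}"] by auto

lemma exists_above2: "\<lbrakk>a \<in> K; b \<in> K\<rbrakk> \<Longrightarrow> \<exists>c\<in>K. a \<in> before c \<and> b \<in> before c"
  using small_bounded[of "{a, b}"] finite_small[of "{a, b}"] by auto

text \<open>Replaces an arbitrary small index set by an initial segment, so that statements about
  small families can be proved by induction along the well-order.\<close>

lemma small_eq_image_before:
  assumes "A \<prec> K"
  obtains a f where "a \<in> K" "A \<subseteq> f ` before a" "f ` before a \<subseteq> insert d A"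
proof -
  obtain g where g: "inj_on g A" "g ` A \<subseteq> K"
    using assms lesspoll_imp_lepoll unfolding lepoll_def by blast
  have "g ` A \<prec> K"
    using assms small_image by blast
  then obtain a where a: "a \<in> K" "g ` A \<subseteq> before a"
    using small_bounded[OF g(2)] by blast
  have "A \<lesssim> before a"
    unfolding lepoll_def using g(1) a(2) by blast
  then obtain f where "A \<subseteq> f ` before a" "f ` before a \<subseteq> insert d A"
    by (rule lepoll_enumeration[where d = d])
  then show ?thesis
    using that a(1) by blast
qed

text \<open>The fibres of the first coordinate of a bijection from \<open>K\<close> onto
  \<open>K \<times> K\<close> have full size, so no proper initial segment contains one. This cuts
  \<open>K\<close> into kappa many cofinal pieces.\<close>

lemma unbounded_fibres: "\<exists>\<pi>. \<forall>i\<in>K. \<forall>c\<in>K. \<exists>a\<in>K. \<pi> a = i \<and> c \<in> before a"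
proof -
  have "|K \<times> K| =o |K|"
    using infinite_K by (simp add: card_of_Times_same_infinite)
  then obtain h where h: "bij_betw h K (K \<times> K)"
    using card_of_ordIso ordIso_symmetric by blast
  have "\<exists>a\<in>K. fst (h a) = i \<and> c \<in> before a" if "i \<in> K" "c \<in> K" for i c
  proof (rule ccontr)
    assume "\<not> ?thesis"
    then have sub: "{a \<in> K. fst (h a) = i} \<subseteq> insert c (before c)"
      using before_cases that by blast
    have "K \<lesssim> {a \<in> K. fst (h a) = i}"
      unfolding lepoll_def
    proof (intro exI conjI)
      show "inj_on (\<lambda>k. inv_into K h (i, k)) K"
        using bij_betw_inv_into[OF h] that(1) by (auto simp: bij_betw_def inj_on_def)
      show "(\<lambda>k. inv_into K h (i, k)) ` K \<subseteq> {a \<in> K. fst (h a) = i}"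
        using h that(1) by (auto simp: bij_betw_def f_inv_into_f intro!: inv_into_into)
    qed
    then have "K \<lesssim> insert c (before c)"
      by (rule lepoll_trans[OF _ subset_imp_lepoll[OF sub]])
    then show False
      using small_insert_before lesspoll_trans1 by blast
  qed
  then show ?thesis
    by (intro exI[of _ "\<lambda>a. fst (h a)"]) auto
qed

end

text \<open>Koenig's diagonal argument.\<close>

lemma regular_cardinal_if_kappa_lt_kappa_eq:
  assumes inf: "infinite K" and kap: "kappa_lt_kappa_eq K"
  shows "regular_cardinal K"
proof (rule regular_cardinal.intro)
  fix A assume A: "A \<subseteq> K" "A \<prec> K"
  show "\<exists>b\<in>K. A \<subseteq> underS (card_of K) b"
  proof (rule ccontr)
    assume unb: "\<not> ?thesis"
    let ?S = "\<lambda>a. insert a (underS (card_of K) a)"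
    have cover: "\<exists>a\<in>A. b \<in> ?S a" if "b \<in> K" for b
    proof -
      have "\<not> A \<subseteq> underS (card_of K) b"
        using unb that by metis
      then obtain a where "a \<in> A" "a \<notin> underS (card_of K) b"
        by (meson subsetI)
      then show ?thesis
        using underS_card_of_cases[OF that, of a] A by blast
    qed
    have small: "?S a \<prec> K" if "a \<in> A" for a
    proof -
      have *: "underS (card_of K) a \<prec> K"
        using that A card_of_underS[OF card_of_Card_order, of a K]
        by (auto simp: Field_card_of lesspoll_iff_card_of_ordLess)
      show ?thesis
      proof (cases "finite (underS (card_of K) a)")
        case True
        then show ?thesis
          by (simp add: inf finite_lesspoll_infinite)
      next
        case False
        then show ?thesis
          by (rule eq_lesspoll_trans[OF infinite_insert_eqpoll *])
      qed
    qed
    have "(A \<rightarrow>\<^sub>E K) \<subseteq> (\<Union>A\<in>{A. A \<subseteq> K \<and> A \<prec> K}. A \<rightarrow>\<^sub>E K)"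
      by (rule UN_upper) (simp add: A)
    then have "(A \<rightarrow>\<^sub>E K) \<lesssim> K"
      by (rule lepoll_trans2[OF subset_imp_lepoll kap[unfolded kappa_lt_kappa_eq_def]])
    then obtain \<phi> where \<phi>: "(A \<rightarrow>\<^sub>E K) \<subseteq> \<phi> ` K"
      unfolding lepoll_iff by (elim exE)
    have "\<exists>y\<in>K. y \<notin> (\<lambda>k. \<phi> k a) ` ?S a" if "a \<in> A" for a
    proof (rule ccontr)
      assume "\<not> ?thesis"
      then have "K \<lesssim> ?S a"
        by (intro subset_image_lepoll[where f = "\<lambda>k. \<phi> k a"] subsetI) (rule ccontr, simp)
      then have "K \<prec> K"
        by (rule lesspoll_trans1[OF _ small[OF that]])
      then show False
        by simp
    qed
    then obtain f where f: "\<And>a. a \<in> A \<Longrightarrow> f a \<in> K \<and> f a \<notin> (\<lambda>k. \<phi> k a) ` ?S a"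
      by metis
    then have "restrict f A \<in> A \<rightarrow>\<^sub>E K"
      by auto
    then have "restrict f A \<in> \<phi> ` K"
      using \<phi> by (rule subsetD[rotated])
    then obtain k where k: "k \<in> K" "restrict f A = \<phi> k"
      by (rule imageE) simp
    then obtain a where "a \<in> A" "k \<in> ?S a"
      using cover[of k] by metis
    then show False
      using f[of a] k by (metis image_eqI restrict_apply')
  qed
qed (fact inf)

section \<open>Compact zero-dimensional spaces\<close>

lemma clopenin_empty [simp]: "clopenin X {}"
  and clopenin_topspace [simp]: "clopenin X (topspace X)"
  and clopenin_Un: "\<lbrakk>clopenin X S; clopenin X T\<rbrakk> \<Longrightarrow> clopenin X (S \<union> T)"
  and clopenin_Int: "\<lbrakk>clopenin X S; clopenin X T\<rbrakk> \<Longrightarrow> clopenin X (S \<inter> T)"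
  and clopenin_Diff: "\<lbrakk>clopenin X S; clopenin X T\<rbrakk> \<Longrightarrow> clopenin X (S - T)"
  by (simp_all add: clopenin_def openin_Un closedin_Un openin_Int closedin_Int openin_diff closedin_diff)

lemma clopenin_subset: "clopenin X S \<Longrightarrow> S \<subseteq> topspace X"
  by (simp add: clopenin_def openin_subset)

lemma clopenin_Union: "\<lbrakk>finite \<C>; \<And>C. C \<in> \<C> \<Longrightarrow> clopenin X C\<rbrakk> \<Longrightarrow> clopenin X (\<Union>\<C>)"
  by (induction rule: finite_induct) (auto intro: clopenin_Un)

lemma clopenin_closure_subset: "\<lbrakk>clopenin X G; W \<subseteq> G\<rbrakk> \<Longrightarrow> X closure_of W \<subseteq> G"
  by (simp add: closure_of_minimal clopenin_def)

lemma clopenin_closure_disjoint: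
  assumes "clopenin X G" "W \<inter> G = {}"
  shows "X closure_of W \<inter> G = {}"
  using assms openin_Int_closure_of_eq_empty[of X G W] by (auto simp: clopenin_def Int_commute)

lemma compact_zero_dim_separation:
  assumes "compact_space X" "zero_dim X" and S: "closedin X S" and T: "closedin X T" and "S \<inter> T = {}"
  obtains G where "clopenin X G" "S \<subseteq> G" "G \<inter> T = {}"
proof -
  define \<C> where "\<C> = {C. clopenin X C \<and> C \<inter> T = {}}"
  have "S \<subseteq> \<Union>\<C>"
  proof
    fix s assume "s \<in> S"
    then have "s \<in> topspace X - T" "openin X (topspace X - T)"
      using assms closedin_subset[OF S] by auto
    then obtain C where "clopenin X C" "s \<in> C" "C \<subseteq> topspace X - T"
      using \<open>zero_dim X\<close> unfolding zero_dim_def by meson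
    then show "s \<in> \<Union>\<C>"
      by (auto simp: \<C>_def)
  qed
  moreover have "compactin X S"
    using assms closedin_compact_space by blast
  moreover have "\<And>C. C \<in> \<C> \<Longrightarrow> openin X C"
    by (simp add: \<C>_def clopenin_def)
  ultimately obtain \<F> where "finite \<F>" "\<F> \<subseteq> \<C>" "S \<subseteq> \<Union>\<F>"
    unfolding compactin_def by meson
  moreover from this have "clopenin X (\<Union>\<F>)"
    by (intro clopenin_Union) (auto simp: \<C>_def)
  ultimately show thesis
    using that[of "\<Union>\<F>"] by (auto simp: \<C>_def)
qed

text \<open>By compactness a clopen set is the union of finitely many base sets. This serves twice:
  it bounds the number of clopen sets of \<open>X\<close> by the weight, and the weight of the
  remainder from below by the number of its clopen sets.\<close>

lemma clopenin_lepoll_finite_subsets_of_base: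
  assumes "compact_space X" "is_base X \<B>"
  shows "{C. clopenin X C} \<lesssim> {\<F>. \<F> \<subseteq> \<B> \<and> finite \<F>}"
proof -
  have "\<exists>\<F>. \<F> \<subseteq> \<B> \<and> finite \<F> \<and> \<Union>\<F> = C" if C: "clopenin X C" for C
  proof -
    obtain \<C> where \<C>: "\<C> \<subseteq> \<B>" "\<Union>\<C> = C"
      using assms C unfolding is_base_def clopenin_def by meson
    have "compactin X C"
      using C assms by (simp add: closedin_compact_space clopenin_def)
    moreover have "\<And>B. B \<in> \<C> \<Longrightarrow> openin X B"
      using \<C> assms by (auto simp: is_base_def)
    ultimately obtain \<F> where "finite \<F>" "\<F> \<subseteq> \<C>" "C \<subseteq> \<Union>\<F>"
      using \<C> unfolding compactin_def by (metis subset_refl)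
    then show ?thesis
      using \<C> by (intro exI[of _ \<F>]) auto
  qed
  then obtain F where F: "\<And>C. clopenin X C \<Longrightarrow> F C \<subseteq> \<B> \<and> finite (F C) \<and> \<Union>(F C) = C"
    by metis
  show ?thesis
    unfolding lepoll_def
  proof (intro exI[of _ F] conjI)
    show "inj_on F {C. clopenin X C}"
      by (rule inj_onI) (metis F mem_Collect_eq)
    show "F ` {C. clopenin X C} \<subseteq> {\<F>. \<F> \<subseteq> \<B> \<and> finite \<F>}"
      using F by auto
  qed
qed

lemma continuous_map_indicat_clopenin:
  assumes "clopenin X G"
  shows "continuous_map X euclideanreal (indicat_real G)"
  unfolding continuous_map_def
proof (intro conjI allI impI)
  fix U :: "real set"
  have "{x \<in> topspace X. indicat_real G x \<in> U} =
      (if 1 \<in> U then G else {}) \<union> (if 0 \<in> U then topspace X - G else {})"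
    using clopenin_subset[OF assms] by (auto simp: indicator_def)
  then show "openin X {x \<in> topspace X. indicat_real G x \<in> U}"
    using assms by (auto simp: clopenin_def openin_diff)
qed auto

text \<open>A function with values in the unit interval is expanded into a series
  of multiples of clopen indicators: if \<open>G\<close> separates the upper third of \<open>f\<close> from the lower third,
  then \<open>f - 1/3\<close> on \<open>G\<close> and \<open>f\<close> off \<open>G\<close> both lie between \<open>0\<close> and \<open>2/3\<close>.\<close>

lemma Cstar_embedded_if_clopen_separation:
  assumes "V \<subseteq> topspace X"
    and sep: "\<And>f. \<lbrakk>continuous_map (subtopology X V) euclideanreal f; \<And>x. x \<in> V \<Longrightarrow> 0 \<le> f x \<and> f x \<le> 1\<rbrakk>
      \<Longrightarrow> \<exists>G. clopenin X G \<and> (\<forall>x\<in>V. 2/3 \<le> f x \<longrightarrow> x \<in> G) \<and> (\<forall>x\<in>V. f x \<le> 1/3 \<longrightarrow> x \<notin> G)"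
  shows "Cstar_embedded X V"
  unfolding Cstar_embedded_def
proof (intro allI impI, elim conjE exE)
  fix f M
  assume f: "continuous_map (subtopology X V) euclideanreal f" and M: "\<forall>x\<in>V. \<bar>f x\<bar> \<le> M"
  define M' where "M' = max M 1"
  have M': "M' > 0" "\<And>x. x \<in> V \<Longrightarrow> \<bar>f x\<bar> \<le> M'"
    using M by (auto simp: M'_def intro: order_trans)
  define Q where "Q h \<longleftrightarrow> continuous_map (subtopology X V) euclideanreal h \<and> (\<forall>x\<in>V. 0 \<le> h x \<and> h x \<le> 1)" for h
  obtain G where G: "\<And>h. Q h \<Longrightarrow> clopenin X (G h) \<and> (\<forall>x\<in>V. 2/3 \<le> h x \<longrightarrow> x \<in> G h) \<and> (\<forall>x\<in>V. h x \<le> 1/3 \<longrightarrow> x \<notin> G h)"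
    using sep unfolding Q_def by metis
  define T where "T h = (\<lambda>x. 3/2 * (h x - 1/3 * indicat_real (G h) x))" for h
  have QT: "Q (T h)" if "Q h" for h
    unfolding Q_def
  proof
    show "continuous_map (subtopology X V) euclideanreal (T h)"
      unfolding T_def using that G[OF that] continuous_map_from_subtopology[OF continuous_map_indicat_clopenin]
      by (intro continuous_map_real_mult continuous_map_diff continuous_map_const[THEN iffD2])
        (auto simp: Q_def)
    show "\<forall>x\<in>V. 0 \<le> T h x \<and> T h x \<le> 1"
    proof
      fix x assume x: "x \<in> V"
      show "0 \<le> T h x \<and> T h x \<le> 1"
        using G[OF that] x that by (cases "x \<in> G h") (force simp: T_def Q_def)+
    qed
  qed
  define h0 where "h0 x = (f x + M') / (2 * M')" for x
  have "Q h0"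
    unfolding Q_def
  proof
    show "continuous_map (subtopology X V) euclideanreal h0"
      unfolding h0_def divide_inverse
      by (intro continuous_map_real_mult continuous_map_add continuous_map_const[THEN iffD2] f) auto
    show "\<forall>x\<in>V. 0 \<le> h0 x \<and> h0 x \<le> 1"
      using M' by (force simp: h0_def abs_le_iff divide_simps)
  qed
  define h where "h n = (T ^^ n) h0" for n
  have Qh: "Q (h n)" for n
    by (induction n) (simp_all add: h_def \<open>Q h0\<close> QT)
  \<comment> \<open>Iterating \<open>h = 1/3 * G + 2/3 * T h\<close> expresses \<open>h0\<close> as
    a series of multiples of indicators plus an error term. The functions \<open>h n\<close> are
    known to be continuous only on \<open>V\<close>, the indicators on all of \<open>X\<close>, so
    the series is the extension.\<close>
  define a where "a x k = 1/3 * (2/3)^k * indicat_real (G (h k)) x" for x k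
  have expand: "h0 x = (\<Sum>k<n. a x k) + (2/3)^n * h n x" for x n
  proof (induction n)
    case (Suc n)
    have "h n x = 1/3 * indicat_real (G (h n)) x + 2/3 * h (Suc n) x"
      by (simp add: h_def T_def field_simps)
    then have "(2/3)^n * h n x = a x n + (2/3)^Suc n * h (Suc n) x"
      by (simp add: a_def algebra_simps)
    then show ?case
      using Suc by simp
  qed (simp add: h_def)
  have a_le: "\<bar>a x k\<bar> \<le> 1/3 * (2/3)^k" for x k
    by (simp add: a_def indicator_def)
  have geo: "summable (\<lambda>k. 1/3 * (2/3)^(k + n) :: real)" "(\<Sum>k. 1/3 * (2/3)^(k + n) :: real) = (2/3)^n" for n
  proof -
    have "(\<lambda>k. (2/3)^k :: real) sums (1 / (1 - 2/3))"
      by (rule geometric_sums) simp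
    then have "(\<lambda>k. (1/3 * (2/3)^n) * (2/3)^k :: real) sums ((1/3 * (2/3)^n) * (1 / (1 - 2/3)))"
      by (rule sums_mult)
    then have "(\<lambda>k. 1/3 * (2/3)^(k + n) :: real) sums ((2/3)^n)"
      by (simp add: power_add mult_ac)
    then show "summable (\<lambda>k. 1/3 * (2/3)^(k + n) :: real)" "(\<Sum>k. 1/3 * (2/3)^(k + n) :: real) = (2/3)^n"
      by (auto simp: sums_iff)
  qed
  have summ: "summable (a x)" for x
    by (rule summable_comparison_test[OF _ geo(1)[of 0]]) (use a_le in auto)
  define g where "g x = (\<Sum>k. a x k)" for x
  have tail: "\<bar>g x - (\<Sum>k<n. a x k)\<bar> \<le> (2/3)^n" for x n
  proof -
    have "g x - (\<Sum>k<n. a x k) = (\<Sum>k. a x (k + n))"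
      unfolding g_def using suminf_minus_initial_segment[OF summ[of x], of n] by simp
    also have "\<bar>\<dots>\<bar> \<le> (\<Sum>k. 1/3 * (2/3)^(k + n))"
      using a_le[of x] geo(1)[of n]
      by (intro order_trans[OF summable_rabs suminf_le]) 
        (auto intro: summable_comparison_test[OF _ geo(1)[of n]])
    finally show ?thesis
      by (simp only: geo(2))
  qed
  have lim0: "(\<lambda>n. (2/3)^n :: real) \<longlonglongrightarrow> 0"
    by (rule LIMSEQ_realpow_zero) auto
  have cont_g: "continuous_map X euclideanreal g"
  proof -
    have 1: "continuous_map X euclideanreal (\<lambda>x. \<Sum>k<n. a x k)" for n
      unfolding a_def using G Qh
      by (intro continuous_map_sum continuous_map_real_mult continuous_map_const[THEN iffD2] 
          continuous_map_indicat_clopenin) auto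
    have 2: "\<forall>\<^sub>F n in sequentially. \<forall>x\<in>topspace X. g x \<in> UNIV \<and> dist (\<Sum>k<n. a x k) (g x) < \<epsilon>" if "\<epsilon> > 0" for \<epsilon>
      using order_tendstoD(2)[OF lim0 that]
      by eventually_elim (use tail in \<open>auto simp: dist_real_def abs_minus_commute intro: le_less_trans\<close>)
    show ?thesis
      using Met_TC.continuous_map_uniform_limit[where F = sequentially and f = "\<lambda>n x. \<Sum>k<n. a x k" and g = g and X = X]
        1 2 by simp
  qed
  have g_eq: "g x = h0 x" if "x \<in> V" for x
  proof -
    have "0 \<le> (2/3)^n * h n x \<and> (2/3)^n * h n x \<le> (2/3)^n" for n
      using Qh[of n] that by (simp add: Q_def mult_left_le)
    then have bounds: "h0 x - (2/3)^n \<le> (\<Sum>k<n. a x k) \<and> (\<Sum>k<n. a x k) \<le> h0 x" for n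
      using expand[of x n] by (smt (verit))
    have "(\<lambda>n. \<Sum>k<n. a x k) \<longlonglongrightarrow> h0 x"
    proof (rule real_tendsto_sandwich[of "\<lambda>n. h0 x - (2/3)^n" _ _ "\<lambda>n. h0 x"])
      show "\<forall>\<^sub>F n in sequentially. h0 x - (2/3)^n \<le> (\<Sum>k<n. a x k)"
        "\<forall>\<^sub>F n in sequentially. (\<Sum>k<n. a x k) \<le> h0 x"
        using bounds by simp_all
      show "(\<lambda>n. h0 x - (2/3)^n) \<longlonglongrightarrow> h0 x"
        using tendsto_diff[OF tendsto_const lim0] by simp
    qed auto
    then show ?thesis
      unfolding g_def using summable_LIMSEQ[OF summ] LIMSEQ_unique by blast
  qed
  show "\<exists>g. continuous_map X euclideanreal g \<and> (\<forall>x\<in>V. g x = f x)"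
  proof (intro exI conjI ballI)
    show "continuous_map X euclideanreal (\<lambda>x. 2 * M' * g x - M')"
      by (intro continuous_map_real_mult continuous_map_diff continuous_map_const[THEN iffD2] cont_g) auto
    show "2 * M' * g x - M' = f x" if "x \<in> V" for x
      using g_eq[OF that] M' by (simp add: h0_def)
  qed
qed

section \<open>The punctured space\<close>

lemma zero_dimE:
  assumes "zero_dim X" "openin X W" "y \<in> W"
  obtains G where "clopenin X G" "y \<in> G" "G \<subseteq> W"
  using assms unfolding zero_dim_def by metis

section \<open>Compact open subsets of \<open>Y\<close> and the ideal of far sets\<close>

text \<open>\<open>C\<close> enumerates, possibly with repetitions, the compact open subsets of
  \<open>Y\<close>. They cover \<open>Y\<close> and are closed under finite unions, so every compact
  subset of \<open>Y\<close> lies in one of them.\<close>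

locale punctured = regular_cardinal K for K :: "'k set" +
  fixes X :: "'a topology" and x :: 'a and C :: "'k \<Rightarrow> 'a set"
  assumes Parovicenko: "Parovicenko K X"
    and x_in: "x \<in> topspace X"
    and range_C: "C ` K = {G. clopenin X G \<and> x \<notin> G}"
begin

abbreviation Y :: "'a topology" where
  "Y \<equiv> subtopology X (topspace X - {x})"

definition U :: "'k \<Rightarrow> 'a set" where
  "U a = (\<Union>b\<in>before a. C b)"

text \<open>The sets that are far from \<open>x\<close> are those contained in a compact subset of \<open>Y\<close>.\<close>

definition far :: "'a set \<Rightarrow> bool" where
  "far W \<longleftrightarrow> (\<exists>a\<in>K. W \<subseteq> C a)"

lemma compact: "compact_space X" and Hausdorff: "Hausdorff_space X" and zero_dim: "zero_dim X"
  and F_space: "F_space K X" and G_space: "G_space K X" and not_isolated: "\<not> isolated_point X y"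
  using Parovicenko by (auto simp: Parovicenko_def)

lemma open_Y: "openin X (topspace X - {x})"
  using Hausdorff x_in by (simp add: closedin_Hausdorff_singleton openin_diff)

lemma C: "a \<in> K \<Longrightarrow> clopenin X (C a) \<and> x \<notin> C a"
  using range_C by blast

lemma C_subset: "a \<in> K \<Longrightarrow> C a \<subseteq> topspace Y"
  using C clopenin_subset by fastforce

lemma C_surj: "\<lbrakk>clopenin X G; x \<notin> G\<rbrakk> \<Longrightarrow> \<exists>a\<in>K. G = C a"
  using range_C by blast

lemma clopenin_Y_if_clopenin: "\<lbrakk>clopenin X G; x \<notin> G\<rbrakk> \<Longrightarrow> clopenin Y G"
  unfolding clopenin_def
  by (metis closedin_subset_topspace closedin_subset openin_subset openin_open_subtopology open_Y 
      Diff_empty subset_Diff_insert)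

lemma openin_X_if_openin_Y: "openin Y W \<Longrightarrow> openin X W"
  using open_Y openin_open_subtopology by blast

lemma closedin_X_Int:
  assumes "closedin Y D" "clopenin X G" "x \<notin> G"
  shows "closedin X (D \<inter> G)"
proof -
  obtain T where T: "closedin X T" "D = T \<inter> (topspace X - {x})"
    using assms by (auto simp: closedin_subtopology)
  then have "D \<inter> G = T \<inter> G"
    using assms clopenin_subset by blast
  then show ?thesis
    using T assms by (simp add: clopenin_def closedin_Int)
qed

lemma clopenin_X_Int: "\<lbrakk>clopenin Y D; clopenin X G; x \<notin> G\<rbrakk> \<Longrightarrow> clopenin X (D \<inter> G)"
  using closedin_X_Int openin_X_if_openin_Y by (auto simp: clopenin_def openin_Int)

lemma ex_C_between:
  assumes "openin X W" "y \<in> W" "y \<noteq> x"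
  shows "\<exists>a\<in>K. y \<in> C a \<and> C a \<subseteq> W"
proof -
  have "openin X (W \<inter> (topspace X - {x}))" "y \<in> W \<inter> (topspace X - {x})"
    using assms open_Y openin_subset by (auto intro: openin_Int)
  then obtain G where "clopenin X G" "y \<in> G" "G \<subseteq> W \<inter> (topspace X - {x})"
    using zero_dim unfolding zero_dim_def by meson
  then show ?thesis
    using C_surj[of G] by auto
qed

lemma ex_C: "y \<in> topspace Y \<Longrightarrow> \<exists>a\<in>K. y \<in> C a"
  using ex_C_between[of "topspace X" y] by auto

lemma clopenin_YI:
  assumes "D \<subseteq> topspace Y" "\<And>a. a \<in> K \<Longrightarrow> clopenin X (D \<inter> C a)"
  shows "clopenin Y D"
proof -
  have *: "openin Y W" if "W \<subseteq> topspace Y" "\<And>a. a \<in> K \<Longrightarrow> openin X (W \<inter> C a)" for W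
  proof -
    have "W = (\<Union>a\<in>K. W \<inter> C a)"
      using that(1) ex_C by blast
    moreover have "openin X (\<Union>a\<in>K. W \<inter> C a)"
      using that(2) by blast
    ultimately show ?thesis
      using that(1) open_Y openin_open_subtopology[of X "topspace X - {x}" W] by auto
  qed
  have "openin X ((topspace Y - D) \<inter> C a)" if "a \<in> K" for a
  proof -
    have "(topspace Y - D) \<inter> C a = C a - D \<inter> C a"
      using C_subset[OF that] by blast
    then show ?thesis
      using assms(2) C that clopenin_Diff by (metis clopenin_def)
  qed
  then have "openin Y (topspace Y - D)"
    by (intro *) auto
  moreover have "openin Y D"
    using assms by (intro *) (auto simp: clopenin_def)
  ultimately show ?thesis
    using assms(1) unfolding clopenin_def closedin_def by blast
qed

lemma U_subset: "U a \<subseteq> topspace Y"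
  unfolding U_def using C_subset before_in by blast

lemma U_mono: "b \<in> before a \<Longrightarrow> U b \<subseteq> U a"
  unfolding U_def using before_trans by blast

lemma C_subset_U: "b \<in> before a \<Longrightarrow> C b \<subseteq> U a"
  unfolding U_def by blast

lemma far_subset: "\<lbrakk>far W; W' \<subseteq> W\<rbrakk> \<Longrightarrow> far W'"
  unfolding far_def by blast

lemma far_clopenin: "\<lbrakk>clopenin X G; x \<notin> G\<rbrakk> \<Longrightarrow> far G"
  unfolding far_def using C_surj by blast

lemma far_C: "a \<in> K \<Longrightarrow> far (C a)"
  unfolding far_def by blast

lemma far_empty: "far {}"
  by (rule far_clopenin) simp_all

lemma far_Un: "\<lbrakk>far W; far W'\<rbrakk> \<Longrightarrow> far (W \<union> W')"
proof -
  assume "far W" "far W'"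
  then obtain a b where ab: "a \<in> K" "b \<in> K" "W \<subseteq> C a" "W' \<subseteq> C b"
    by (auto simp: far_def)
  then have "far (C a \<union> C b)"
    using C by (intro far_clopenin clopenin_Un) auto
  then show ?thesis
    by (rule far_subset) (use ab in auto)
qed

lemma far_UN: "\<lbrakk>finite T; \<And>t. t \<in> T \<Longrightarrow> far (W t)\<rbrakk> \<Longrightarrow> far (\<Union>t\<in>T. W t)"
  by (induction rule: finite_induct) (auto simp: far_empty intro: far_Un)

lemma clopenin_X_iff_far: "clopenin Y D \<Longrightarrow> clopenin X D \<longleftrightarrow> far D"
proof
  assume D: "clopenin Y D"
  show "far D" if "clopenin X D"
    using that clopenin_subset[OF D] by (intro far_clopenin) auto
  show "clopenin X D" if far: "far D"
  proof -
    obtain a where "a \<in> K" "D \<subseteq> C a"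
      using far by (auto simp: far_def)
    then show ?thesis
      using clopenin_X_Int[OF D, of "C a"] C by (simp add: Int_absorb2)
  qed
qed

text \<open>Regularity puts the indices of the bounding sets \<open>C (c i)\<close> below a single
  \<open>a\<close>. The bound is only \<open>U a\<close>; concluding that such a union is itself far
  takes tameness.\<close>

lemma far_small_subset_U:
  assumes "I \<prec> K" "\<And>i. i \<in> I \<Longrightarrow> far (W i)"
  shows "\<exists>a\<in>K. (\<Union>i\<in>I. W i) \<subseteq> U a"
proof -
  obtain c where c: "\<And>i. i \<in> I \<Longrightarrow> c i \<in> K \<and> W i \<subseteq> C (c i)"
    using assms(2) unfolding far_def by metis
  have "c ` I \<prec> K" "c ` I \<subseteq> K"
    using assms(1) c small_image by auto
  then obtain a where "a \<in> K" "c ` I \<subseteq> before a"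
    using small_bounded by blast
  then show ?thesis
    using c C_subset_U by (intro bexI[of _ a]) blast+
qed

section \<open>Open sets of type below kappa and the two properties of \<open>X\<close>\<close>

lemma openin_type_less: "type_less X W L \<Longrightarrow> openin X W"
  unfolding type_less_def clopenin_def by blast

lemma type_less_UN:
  assumes "I \<prec> K" "\<And>i. i \<in> I \<Longrightarrow> clopenin X (A i)"
  shows "type_less X (\<Union>i\<in>I. A i) K"
  unfolding type_less_def using assms small_image by (intro exI[of _ "A ` I"]) auto

lemma type_less_Un: "\<lbrakk>type_less X V K; type_less X W K\<rbrakk> \<Longrightarrow> type_less X (V \<union> W) K"
proof -
  assume "type_less X V K" "type_less X W K"
  then obtain \<A> \<B> where "\<forall>C\<in>\<A>. clopenin X C" "\<Union>\<A> = V" "\<A> \<prec> K" "\<forall>C\<in>\<B>. clopenin X C" "\<Union>\<B> = W" "\<B> \<prec> K"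
    unfolding type_less_def by metis
  then show ?thesis
    unfolding type_less_def by (intro exI[of _ "\<A> \<union> \<B>"]) (auto simp: small_Un)
qed

text \<open>The indicator of \<open>V\<close> is continuous on \<open>V \<union> W\<close>, an open
  set of type below kappa, and so extends to \<open>X\<close>. The parts where the extension is at
  least \<open>1\<close> and at most \<open>0\<close> are then separated by compactness.\<close>

lemma clopen_separation:
  assumes V: "type_less X V K" and W: "type_less X W K" and disj: "V \<inter> W = {}"
  obtains G where "clopenin X G" "V \<subseteq> G" "G \<inter> W = {}"
proof -
  let ?S = "subtopology X (V \<union> W)"
  have op: "openin X V" "openin X W"
    using V W openin_type_less by auto
  have "openin ?S V" "openin ?S W"
    using op by (simp_all add: openin_open_subtopology openin_Un)
  moreover have "topspace ?S = V \<union> W"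
    using op[THEN openin_subset] by auto
  moreover from this have "V = topspace ?S - W"
    using disj by auto
  ultimately have "clopenin ?S V"
    unfolding clopenin_def using closedin_def by (metis closedin_diff closedin_topspace)
  then have cont: "continuous_map ?S euclideanreal (indicat_real V)"
    by (rule continuous_map_indicat_clopenin)
  have Cstar: "Cstar_embedded X (V \<union> W)"
    using F_space type_less_Un[OF V W] op unfolding F_space_def by (simp add: openin_Un)
  have bdd: "\<exists>M. \<forall>y\<in>V \<union> W. \<bar>indicat_real V y\<bar> \<le> M"
    by (intro exI[of _ 1]) (simp add: indicator_def)
  obtain g where g: "continuous_map X euclideanreal g" "\<And>y. y \<in> V \<union> W \<Longrightarrow> g y = indicat_real V y"
    using Cstar[unfolded Cstar_embedded_def, rule_format, OF conjI[OF cont bdd]] by blast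
  have "closedin euclideanreal {1..}" "closedin euclideanreal {..0}"
    by (simp_all only: closed_closedin[symmetric] closed_atLeast closed_atMost)
  then have cl: "closedin X {y \<in> topspace X. g y \<in> {1..}}" "closedin X {y \<in> topspace X. g y \<in> {..0}}"
    using closedin_continuous_map_preimage[OF g(1)] by metis+
  obtain G where G: "clopenin X G" "{y \<in> topspace X. g y \<in> {1..}} \<subseteq> G" "G \<inter> {y \<in> topspace X. g y \<in> {..0}} = {}"
    using compact_zero_dim_separation[OF compact zero_dim cl] by force
  have "g y = 1" "y \<in> topspace X" if "y \<in> V" for y
    using that g(2) op[THEN openin_subset] by auto
  then have "V \<subseteq> G"
    using G(2) by (auto simp: subset_iff)
  moreover have "g y = 0" "y \<in> topspace X" if "y \<in> W" for y
    using that g(2) disj op[THEN openin_subset] by (auto simp: indicator_def)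
  then have "G \<inter> W = {}"
    using G(3) by (auto simp: disjoint_iff)
  ultimately have "V \<subseteq> G" "G \<inter> W = {}"
    by simp_all
  then show thesis
    using that G(1) by blast
qed

text \<open>The \<open>G\<close> property is applied at \<open>q\<close> within a compact
  \<open>C a\<close>: the complement of \<open>H i\<close> need not be open at \<open>x\<close>, but
  \<open>C a - H i\<close> is open in \<open>X\<close>.\<close>

lemma ex_clopen_avoiding:
  assumes "openin X W" "q \<in> W" "q \<noteq> x" and "I \<prec> K"
    and H: "\<And>i. i \<in> I \<Longrightarrow> clopenin Y (H i) \<and> q \<notin> H i"
  obtains P where "clopenin X P" "P \<noteq> {}" "x \<notin> P" "P \<subseteq> W" "\<forall>i\<in>I. P \<inter> H i = {}"
proof -
  obtain a where a: "a \<in> K" "q \<in> C a" "C a \<subseteq> W"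
    using ex_C_between assms by blast
  define \<U> where "\<U> = insert (C a) ((\<lambda>i. C a - H i) ` I)"
  have "\<U> \<prec> K"
    unfolding \<U>_def using small_Un[OF finite_small[of "{C a}"] small_image[OF \<open>I \<prec> K\<close>]] by simp
  moreover have "openin X (C a - H i)" if "i \<in> I" for i
  proof -
    have "C a - H i = C a - H i \<inter> C a"
      by blast
    then show ?thesis
      using clopenin_Diff clopenin_X_Int H that C[OF a(1)] by (metis clopenin_def)
  qed
  then have "\<forall>V\<in>\<U>. openin X V"
    using C[OF a(1)] by (auto simp: \<U>_def clopenin_def)
  moreover have "q \<in> topspace X \<inter> \<Inter>\<U>"
    using a H C_subset by (auto simp: \<U>_def)
  ultimately have "X interior_of (topspace X \<inter> \<Inter>\<U>) \<noteq> {}"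
    using G_space unfolding G_space_def by blast
  then obtain z where "z \<in> X interior_of (topspace X \<inter> \<Inter>\<U>)"
    by blast
  then obtain P where P: "clopenin X P" "z \<in> P" "P \<subseteq> X interior_of (topspace X \<inter> \<Inter>\<U>)"
    by (rule zero_dimE[OF zero_dim openin_interior_of])
  then have "P \<subseteq> \<Inter>\<U>"
    using interior_of_subset[of X "topspace X \<inter> \<Inter>\<U>"] by blast
  then have sub: "P \<subseteq> C a" and disj: "\<forall>i\<in>I. P \<inter> H i = {}"
    unfolding \<U>_def by blast+
  show thesis
  proof (rule that[of P])
    show "P \<noteq> {}" "x \<notin> P" "P \<subseteq> W"
      using P(2) sub a C[OF a(1)] by auto
  qed (fact P(1) disj)+
qed

lemma split_clopen:
  assumes "clopenin X P" "P \<noteq> {}"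
  obtains Q R where "clopenin X Q" "clopenin X R" "Q \<noteq> {}" "R \<noteq> {}" "Q \<inter> R = {}" "Q \<subseteq> P" "R \<subseteq> P"
proof -
  obtain y where y: "y \<in> P" "y \<in> topspace X"
    using assms clopenin_subset by blast
  then have "P \<noteq> {y}"
    using not_isolated[of y] assms unfolding isolated_point_def clopenin_def by blast
  then obtain z where z: "z \<in> P" "z \<noteq> y"
    using y by blast
  have "openin X (P - {y})"
    using assms y Hausdorff by (auto simp: clopenin_def closedin_Hausdorff_singleton intro: openin_diff)
  then obtain Q where "clopenin X Q" "z \<in> Q" "Q \<subseteq> P - {y}"
    using z zero_dimE[OF zero_dim, of "P - {y}" z] by auto
  then show thesis
    using that[of Q "P - Q"] assms y by (auto simp: clopenin_Diff)
qed

section \<open>Recursion along the cover of \<open>Y\<close> and strong zero-dimensionality\<close>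

text \<open>\<open>E\<close> is decided on one \<open>C a\<close> after another. At stage
  \<open>a\<close> its trace on \<open>U a\<close> is already fixed, \<open>G0\<close> being inside
  and \<open>G1\<close> outside; \<open>step\<close> continues this partition while respecting
  \<open>W0\<close> and \<open>W1\<close> on \<open>C a\<close>. Only the trace of \<open>F\<close>
  on \<open>C a\<close> is kept, so \<open>F\<close> may contain \<open>x\<close>.\<close>

lemma clopen_recursion:
  assumes W: "W0 \<subseteq> topspace Y" "W1 \<subseteq> topspace Y"
    and step: "\<And>a G0 G1. \<lbrakk>a \<in> K; G0 \<inter> G1 = {}; G0 \<union> G1 = U a; type_less X G0 K; type_less X G1 K;
        G0 \<inter> W1 = {}; G1 \<inter> W0 = {}\<rbrakk>
      \<Longrightarrow> \<exists>F. clopenin X F \<and> G0 \<subseteq> F \<and> F \<inter> G1 = {} \<and> W0 \<inter> C a \<subseteq> F \<and> F \<inter> (W1 \<inter> C a) = {}"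
  obtains E where "clopenin Y E" "W0 \<subseteq> E" "E \<inter> W1 = {}"
proof -
  define good where "good f a F \<longleftrightarrow> a \<in> K \<longrightarrow>
      clopenin X F \<and> (\<forall>b\<in>before a. F \<inter> C b = f b \<inter> C b) \<and> W0 \<inter> C a \<subseteq> F \<and> F \<inter> (W1 \<inter> C a) = {}"
    for f :: "'k \<Rightarrow> 'a set" and a F
  have "\<exists>f. \<forall>a. good f a (f a)"
  proof (rule dependent_wf_choice[OF wf_before])
    show "good f a F = good g a F" if "\<And>b. (b, a) \<in> {(b, a). b \<in> before a} \<Longrightarrow> f b = g b" for f g a F
      using that by (auto simp: good_def)
    show "\<exists>F. good f a F" if "\<And>b. (b, a) \<in> {(b, a). b \<in> before a} \<Longrightarrow> good f b (f b)" for a f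
    proof (cases "a \<in> K")
      case True
      have IH: "clopenin X (f b)" "\<And>d. d \<in> before b \<Longrightarrow> f b \<inter> C d = f d \<inter> C d"
          "W0 \<inter> C b \<subseteq> f b" "f b \<inter> (W1 \<inter> C b) = {}" if "b \<in> before a" for b
        using \<open>\<And>b. (b, a) \<in> {(b, a). b \<in> before a} \<Longrightarrow> good f b (f b)\<close>[of b] that before_in[OF that]
        by (auto simp: good_def)
      have agree: "p \<in> f b \<longleftrightarrow> p \<in> f d" if "b \<in> before a" "d \<in> before a" "p \<in> C b" "p \<in> C d" for b d p
        using before_cases[OF before_in before_in, OF that(1,2)] IH(2)[of b d] IH(2)[of d b] that by blast
      define G0 where "G0 = (\<Union>b\<in>before a. f b \<inter> C b)"
      define G1 where "G1 = (\<Union>b\<in>before a. C b - f b)"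
      have "\<exists>F. clopenin X F \<and> G0 \<subseteq> F \<and> F \<inter> G1 = {} \<and> W0 \<inter> C a \<subseteq> F \<and> F \<inter> (W1 \<inter> C a) = {}"
      proof (rule step[OF True])
        show "G0 \<inter> G1 = {}"
          using agree unfolding G0_def G1_def by blast
        show "G0 \<union> G1 = U a"
          unfolding G0_def G1_def U_def by blast
        show "type_less X G0 K" "type_less X G1 K"
          unfolding G0_def G1_def using IH(1) C before_in
          by (auto intro!: type_less_UN before_small clopenin_Int clopenin_Diff)
        show "G0 \<inter> W1 = {}" "G1 \<inter> W0 = {}"
          unfolding G0_def G1_def using IH(3,4) by blast+
      qed
      then obtain F where F: "clopenin X F" "G0 \<subseteq> F" "F \<inter> G1 = {}" "W0 \<inter> C a \<subseteq> F" "F \<inter> (W1 \<inter> C a) = {}"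
        by blast
      have "F \<inter> C b = f b \<inter> C b" if "b \<in> before a" for b
        using that F(2,3) unfolding G0_def G1_def by blast
      then show ?thesis
        using F unfolding good_def by blast
    qed (simp add: good_def)
  qed
  then obtain f where f: "\<And>a. good f a (f a)"
    by blast
  have f1: "clopenin X (f a)" "W0 \<inter> C a \<subseteq> f a" "f a \<inter> (W1 \<inter> C a) = {}" if "a \<in> K" for a
    using f[of a] that unfolding good_def by blast+
  have f2: "f a \<inter> C b = f b \<inter> C b" if "a \<in> K" "b \<in> before a" for a b
    using f[of a] that unfolding good_def by blast
  define E where "E = (\<Union>a\<in>K. f a \<inter> C a)"
  have E_Int: "E \<inter> C a = f a \<inter> C a" if "a \<in> K" for a
  proof -
    have "f b \<inter> C b \<inter> C a \<subseteq> f a" if "b \<in> K" for b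
      using before_cases[OF \<open>a \<in> K\<close> that] f2[of a b] f2[of b a] that \<open>a \<in> K\<close> by blast
    then show ?thesis
      using that unfolding E_def by blast
  qed
  have "clopenin Y E"
  proof (rule clopenin_YI)
    show "E \<subseteq> topspace Y"
      unfolding E_def using C_subset by blast
    show "clopenin X (E \<inter> C a)" if "a \<in> K" for a
      using that E_Int f1(1) C clopenin_Int by metis
  qed
  moreover have "W0 \<subseteq> E"
    using W(1) ex_C f1(2) unfolding E_def by blast
  moreover have "E \<inter> W1 = {}"
    using f1(3) unfolding E_def by blast
  ultimately show thesis
    using that by blast
qed

text \<open>Fewer than kappa members are visible on \<open>C a\<close>, so at stage \<open>a\<close>
  of the recursion both sides have type below kappa and can be separated in \<open>X\<close>.
  Applications arrange that the \<open>i\<close>-th set misses \<open>C a\<close> for all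
  \<open>a\<close> before \<open>i\<close>.\<close>

lemma separate_locally_small:
  assumes A: "\<And>i. i \<in> I \<Longrightarrow> clopenin Y (A i)" and B: "\<And>j. j \<in> J \<Longrightarrow> clopenin Y (B j)"
    and small_A: "\<And>a. a \<in> K \<Longrightarrow> {i \<in> I. A i \<inter> C a \<noteq> {}} \<prec> K"
    and small_B: "\<And>a. a \<in> K \<Longrightarrow> {j \<in> J. B j \<inter> C a \<noteq> {}} \<prec> K"
    and disj: "\<And>i j. \<lbrakk>i \<in> I; j \<in> J\<rbrakk> \<Longrightarrow> A i \<inter> B j = {}"
  obtains E where "clopenin Y E" "\<forall>i\<in>I. A i \<subseteq> E" "\<forall>j\<in>J. E \<inter> B j = {}"
proof -
  let ?A = "\<Union>i\<in>I. A i" and ?B = "\<Union>j\<in>J. B j"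
  have type_A: "type_less X (?A \<inter> C a) K" if "a \<in> K" for a
  proof -
    have "?A \<inter> C a = (\<Union>i\<in>{i \<in> I. A i \<inter> C a \<noteq> {}}. A i \<inter> C a)"
      by blast
    then show ?thesis
      using type_less_UN[OF small_A[OF that], of "\<lambda>i. A i \<inter> C a"] clopenin_X_Int[OF A] C[OF that] by auto
  qed
  have type_B: "type_less X (?B \<inter> C a) K" if "a \<in> K" for a
  proof -
    have "?B \<inter> C a = (\<Union>i\<in>{i \<in> J. B i \<inter> C a \<noteq> {}}. B i \<inter> C a)"
      by blast
    then show ?thesis
      using type_less_UN[OF small_B[OF that], of "\<lambda>i. B i \<inter> C a"] clopenin_X_Int[OF B] C[OF that] by auto
  qed
  obtain E where "clopenin Y E" "?A \<subseteq> E" "E \<inter> ?B = {}"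
  proof (rule clopen_recursion[of ?A ?B])
    show "?A \<subseteq> topspace Y" "?B \<subseteq> topspace Y"
      using clopenin_subset[OF A] clopenin_subset[OF B] by blast+
  next
    fix a G0 G1
    assume a: "a \<in> K" and G: "G0 \<inter> G1 = {}" "G0 \<union> G1 = U a" "type_less X G0 K" "type_less X G1 K"
      "G0 \<inter> ?B = {}" "G1 \<inter> ?A = {}"
    have disj': "(G0 \<union> ?A \<inter> C a) \<inter> (G1 \<union> ?B \<inter> C a) = {}"
      using G disj by blast
    obtain F where "clopenin X F" "G0 \<union> ?A \<inter> C a \<subseteq> F" "F \<inter> (G1 \<union> ?B \<inter> C a) = {}"
      by (rule clopen_separation[OF type_less_Un[OF G(3) type_A[OF a]] type_less_Un[OF G(4) type_B[OF a]] disj'])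
    then show "\<exists>F. clopenin X F \<and> G0 \<subseteq> F \<and> F \<inter> G1 = {} \<and> ?A \<inter> C a \<subseteq> F \<and> F \<inter> (?B \<inter> C a) = {}"
      by (intro exI[of _ F]) auto
  qed
  then show thesis
    by (intro that[of E]) blast+
qed

lemma closedin_level_sets:
  assumes f: "continuous_map Y euclideanreal f" and a: "a \<in> K"
  shows "closedin X {y \<in> C a. f y \<le> c}" "closedin X {y \<in> C a. c \<le> f y}"
proof -
  have *: "closedin X {y \<in> C a. g y \<le> c}" if g: "continuous_map Y euclideanreal g" for g and c
  proof -
    have "closedin euclideanreal {..c}"
      by (simp only: closed_closedin[symmetric] closed_atMost)
    then have "closedin Y {y \<in> topspace Y. g y \<in> {..c}}"
      by (rule closedin_continuous_map_preimage[OF g])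
    then have "closedin X ({y \<in> topspace Y. g y \<in> {..c}} \<inter> C a)"
      using C[OF a] by (intro closedin_X_Int) auto
    moreover have "{y \<in> topspace Y. g y \<in> {..c}} \<inter> C a = {y \<in> C a. g y \<le> c}"
      using C_subset[OF a] by auto
    ultimately show ?thesis
      by simp
  qed
  show "closedin X {y \<in> C a. f y \<le> c}"
    by (rule *[OF f])
  have "closedin X {y \<in> C a. - f y \<le> - c}"
    by (rule *) (rule continuous_map_minus[OF f])
  then show "closedin X {y \<in> C a. c \<le> f y}"
    by simp
qed

text \<open>Within \<open>C a\<close>, the set \<open>f < c\<close> is the union over
  \<open>n\<close> of the closed sets \<open>f \<le> c - 1 / Suc n\<close>, each enlarged to a
  clopen set inside \<open>f < c\<close>; a countable union is small because \<open>K\<close> is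
  uncountable.\<close>

lemma type_less_sublevel:
  assumes f: "continuous_map Y euclideanreal f" and a: "a \<in> K" and unc: "(UNIV :: nat set) \<prec> K"
  shows "type_less X ({y \<in> topspace Y. f y < c} \<inter> C a) K"
proof -
  have ex: "\<exists>H. clopenin X H \<and> {y \<in> C a. f y \<le> c - 1 / Suc n} \<subseteq> H \<and> H \<subseteq> {y \<in> C a. f y < c}" for n
  proof -
    have "closedin X ((topspace X - C a) \<union> {y \<in> C a. c \<le> f y})"
      using closedin_level_sets[OF f a] C[OF a] by (auto simp: clopenin_def intro!: closedin_Un)
    moreover have "\<not> c \<le> f y" if "f y \<le> c - 1 / Suc n" for y
    proof -
      have "0 < 1 / real (Suc n)"
        by simp
      then show ?thesis
        using that by linarith
    qed
    then have "{y \<in> C a. f y \<le> c - 1 / Suc n} \<inter> ((topspace X - C a) \<union> {y \<in> C a. c \<le> f y}) = {}"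
      by blast
    ultimately obtain H where H: "clopenin X H" "{y \<in> C a. f y \<le> c - 1 / Suc n} \<subseteq> H" 
        "H \<inter> ((topspace X - C a) \<union> {y \<in> C a. c \<le> f y}) = {}"
      by (rule compact_zero_dim_separation[OF compact zero_dim closedin_level_sets(1)[OF f a]])
    moreover have "H \<subseteq> {y \<in> C a. f y < c}"
      using H(3) clopenin_subset[OF H(1)] by fastforce
    ultimately show ?thesis
      by blast
  qed
  obtain H where "\<forall>n. clopenin X (H n) \<and> {y \<in> C a. f y \<le> c - 1 / Suc n} \<subseteq> H n \<and> H n \<subseteq> {y \<in> C a. f y < c}"
    using choice[OF allI, of "\<lambda>n H. clopenin X H \<and> {y \<in> C a. f y \<le> c - 1 / Suc n} \<subseteq> H \<and> H \<subseteq> {y \<in> C a. f y < c}"] ex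
    by blast
  then have H: "\<And>n. clopenin X (H n)" "\<And>n. {y \<in> C a. f y \<le> c - 1 / Suc n} \<subseteq> H n"
      "\<And>n. H n \<subseteq> {y \<in> C a. f y < c}"
    by simp_all
  have "{y \<in> topspace Y. f y < c} \<inter> C a = (\<Union>n. H n)"
  proof
    show "(\<Union>n. H n) \<subseteq> {y \<in> topspace Y. f y < c} \<inter> C a"
      using H(3) C_subset[OF a] by blast
    show "{y \<in> topspace Y. f y < c} \<inter> C a \<subseteq> (\<Union>n. H n)"
    proof
      fix y assume y: "y \<in> {y \<in> topspace Y. f y < c} \<inter> C a"
      then obtain n where "inverse (real (Suc n)) < c - f y"
        using reals_Archimedean[of "c - f y"] by auto
      then have "y \<in> {y \<in> C a. f y \<le> c - 1 / Suc n}"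
        using y by (simp add: inverse_eq_divide)
      then show "y \<in> (\<Union>n. H n)"
        using H(2) by blast
    qed
  qed
  then show ?thesis
    using type_less_UN[OF unc, of H] H(1) by simp
qed

text \<open>The open sets \<open>f < 1/2\<close> and \<open>f > 1/2\<close> have countable type on each \<open>C a\<close>. This is
  of no use for countable \<open>K\<close>, but then each \<open>U a\<close> is a finite union of clopen sets.\<close>

lemma separate_level_sets:
  assumes f: "continuous_map Y euclideanreal f"
  obtains E where "clopenin Y E" "{y \<in> topspace Y. f y \<le> 1/3} \<subseteq> E" "E \<inter> {y \<in> topspace Y. 2/3 \<le> f y} = {}"
proof (cases "(UNIV :: nat set) \<prec> K")
  case True
  \<comment> \<open>The condition \<open>f > 1/2\<close> is written with \<open>- f\<close>, so that
    \<open>type_less_sublevel\<close> serves both sides.\<close>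
  let ?A = "{y \<in> topspace Y. f y < 1/2}" and ?B = "{y \<in> topspace Y. - f y < - 1/2}"
  obtain E where "clopenin Y E" "?A \<subseteq> E" "E \<inter> ?B = {}"
  proof (rule clopen_recursion[of ?A ?B])
    fix a G0 G1
    assume a: "a \<in> K" and G: "G0 \<inter> G1 = {}" "G0 \<union> G1 = U a" "type_less X G0 K" "type_less X G1 K"
      "G0 \<inter> ?B = {}" "G1 \<inter> ?A = {}"
    have type: "type_less X (?A \<inter> C a) K" "type_less X (?B \<inter> C a) K"
      using type_less_sublevel[OF f a True] type_less_sublevel[OF continuous_map_minus[OF f] a True] by blast+
    have disj: "(G0 \<union> ?A \<inter> C a) \<inter> (G1 \<union> ?B \<inter> C a) = {}"
      using G by auto
    obtain F where "clopenin X F" "G0 \<union> ?A \<inter> C a \<subseteq> F" "F \<inter> (G1 \<union> ?B \<inter> C a) = {}"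
      by (rule clopen_separation[OF type_less_Un[OF G(3) type(1)] type_less_Un[OF G(4) type(2)] disj])
    then show "\<exists>F. clopenin X F \<and> G0 \<subseteq> F \<and> F \<inter> G1 = {} \<and> ?A \<inter> C a \<subseteq> F \<and> F \<inter> (?B \<inter> C a) = {}"
      by (intro exI[of _ F]) blast
  qed auto
  then show thesis
    by (intro that[of E]) force+
next
  case False
  have fin: "finite (before a)" for a
  proof (rule ccontr)
    assume "infinite (before a)"
    then have "(UNIV :: nat set) \<lesssim> before a"
      by (simp add: infinite_le_lepoll)
    then show False
      using False before_small lesspoll_trans1 by blast
  qed
  \<comment> \<open>Here the closed level sets are used: with \<open>U a\<close> clopen,
    \<open>G0\<close> and \<open>G1\<close> are closed as well, and compactness alone separates the
    two sides.\<close>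
  let ?A = "{y \<in> topspace Y. f y \<le> 1/3}" and ?B = "{y \<in> topspace Y. 2/3 \<le> f y}"
  obtain E where "clopenin Y E" "?A \<subseteq> E" "E \<inter> ?B = {}"
  proof (rule clopen_recursion[of ?A ?B])
    fix a G0 G1
    assume a: "a \<in> K" and G: "G0 \<inter> G1 = {}" "G0 \<union> G1 = U a" "type_less X G0 K" "type_less X G1 K"
      "G0 \<inter> ?B = {}" "G1 \<inter> ?A = {}"
    have "clopenin X (U a)"
      unfolding U_def using fin C before_in by (intro clopenin_Union) auto
    then have "closedin X (U a - G1)" "closedin X (U a - G0)"
      using openin_type_less G by (auto simp: clopenin_def intro!: closedin_diff)
    moreover have "U a - G1 = G0" "U a - G0 = G1"
      using G by blast+
    ultimately have "closedin X (G0 \<union> {y \<in> C a. f y \<le> 1/3})" "closedin X (G1 \<union> {y \<in> C a. 2/3 \<le> f y})"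
      by (metis closedin_Un closedin_level_sets[OF f a])+
    moreover have "(G0 \<union> {y \<in> C a. f y \<le> 1/3}) \<inter> (G1 \<union> {y \<in> C a. 2/3 \<le> f y}) = {}"
      using G C_subset[OF a] by fastforce
    ultimately obtain F where "clopenin X F" "G0 \<union> {y \<in> C a. f y \<le> 1/3} \<subseteq> F" "F \<inter> (G1 \<union> {y \<in> C a. 2/3 \<le> f y}) = {}"
      by (rule compact_zero_dim_separation[OF compact zero_dim])
    then show "\<exists>F. clopenin X F \<and> G0 \<subseteq> F \<and> F \<inter> G1 = {} \<and> ?A \<inter> C a \<subseteq> F \<and> F \<inter> (?B \<inter> C a) = {}"
      by (intro exI[of _ F]) auto
  qed auto
  then show thesis
    by (intro that[of E]) force+
qed

section \<open>Accumulation at \<open>x\<close> and small covers of \<open>Y\<close>\<close>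

text \<open>Of a clopen set separating \<open>V\<close> from \<open>W\<close> and its complement,
  one misses \<open>x\<close> and hence is compact in \<open>Y\<close>.\<close>

lemma far_or_far_if_disjoint:
  assumes "type_less X V K" "type_less X W K" "V \<inter> W = {}" "x \<notin> V" "x \<notin> W"
  shows "far V \<or> far W"
proof -
  obtain G where G: "clopenin X G" "V \<subseteq> G" "G \<inter> W = {}"
    by (rule clopen_separation[OF assms(1-3)])
  show ?thesis
  proof (cases "x \<in> G")
    case True
    then have "far (topspace X - G)"
      using G by (intro far_clopenin clopenin_Diff) auto
    moreover have "W \<subseteq> topspace X - G"
      using G openin_subset[OF openin_type_less[OF assms(2)]] by blast
    ultimately show ?thesis
      using far_subset by blast
  next
    case False
    then show ?thesis
      using far_clopenin far_subset G by blast
  qed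
qed

text \<open>By induction along the well-order: if no initial segment has a finite subcover up to a set
  that is far from \<open>x\<close>, one finds two disjoint sequences of clopen sets, each with the part of
  index \<open>c\<close> avoiding the first \<open>c\<close> members of the cover. One of the two
  unions is far from \<open>x\<close>, hence contained in a compact set, which is covered by finitely
  many members.\<close>

lemma finite_subcover_before:
  assumes "a \<in> K" "clopenin Y S" "\<And>b. b \<in> before a \<Longrightarrow> clopenin Y (H b)"
    and "topspace Y \<subseteq> S \<union> (\<Union>b\<in>before a. H b)"
  shows "\<exists>T. T \<subseteq> before a \<and> finite T \<and> far (topspace Y - S - (\<Union>b\<in>T. H b))"
  using wf_before assms
proof (induction a arbitrary: S H rule: wf_induct_rule)
  case (less a)
  have S: "clopenin Y S" and H: "\<And>b. b \<in> before a \<Longrightarrow> clopenin Y (H b)"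
    and cover: "topspace Y \<subseteq> S \<union> (\<Union>b\<in>before a. H b)"
    using less.prems by auto
  have IH: "\<exists>T. T \<subseteq> before c \<and> finite T \<and> far (topspace Y - S' - (\<Union>b\<in>T. H' b))"
    if "c \<in> before a" "clopenin Y S'" "\<And>b. b \<in> before c \<Longrightarrow> clopenin Y (H' b)"
      "topspace Y \<subseteq> S' \<union> (\<Union>b\<in>before c. H' b)" for c S' H'
    using less.IH[of c S' H'] that before_in by auto
  show ?case
  proof (rule ccontr)
    assume no: "\<not> ?case"
    have no_fin: "\<not> far (topspace Y - S - (\<Union>b\<in>T. H b))" if "T \<subseteq> before a" "finite T" for T
      using no that by blast
    have limit: "\<exists>c\<in>before a. m \<in> before c" if m: "m \<in> before a" for m
    proof (rule ccontr)
      assume "\<not> ?thesis"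
      then have succ: "before a \<subseteq> insert m (before m)"
        using before_cases before_in m by blast
      \<comment> \<open>A largest index \<open>m\<close> is absorbed into \<open>S\<close>, and the
        induction hypothesis is applied at \<open>m\<close>; this is why the cover carries the extra
        member \<open>S\<close>.\<close>
      then have "topspace Y \<subseteq> (S \<union> H m) \<union> (\<Union>b\<in>before m. H b)"
        using cover by blast
      then obtain T where T: "T \<subseteq> before m" "finite T" "far (topspace Y - (S \<union> H m) - (\<Union>b\<in>T. H b))"
        using IH[OF m, of "S \<union> H m" H] S H m before_trans clopenin_Un by (metis (no_types, lifting))
      moreover have "topspace Y - (S \<union> H m) - (\<Union>b\<in>T. H b) = topspace Y - S - (\<Union>b\<in>insert m T. H b)"
        by blast
      moreover have "insert m T \<subseteq> before a"
        using T m before_trans by blast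
      ultimately show False
        using no_fin by (metis finite_insert)
    qed
    have before_ne: "before a \<noteq> {}"
      using no_fin[of "{}"] cover far_empty by (auto simp: Diff_eq_empty_iff[THEN iffD2])
    have limit_fin: "\<exists>c\<in>before a. T \<subseteq> before c" if "finite T" "T \<subseteq> before a" for T
      using that
    proof (induction T rule: finite_induct)
      case empty
      then show ?case
        using before_ne by blast
    next
      case (insert m T)
      then obtain c where c: "c \<in> before a" "T \<subseteq> before c"
        by auto
      obtain d where d: "d \<in> before a" "m \<in> before d"
        using limit insert.prems by blast
      have "c = d \<or> c \<in> before d \<or> d \<in> before c"
        using before_cases before_in c d by blast
      then show ?case
        using c d before_trans by blast
    qed
    define good where "good f c p \<longleftrightarrow> c \<in> before a \<longrightarrow>
      clopenin X (fst p) \<and> clopenin X (snd p) \<and> x \<notin> fst p \<union> snd p \<and> fst p \<noteq> {} \<and> snd p \<noteq> {} \<and> fst p \<inter> snd p = {} \<and>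
      fst p \<union> snd p \<subseteq> topspace Y - S \<and> 
      (\<forall>b\<in>before c. (fst p \<union> snd p) \<inter> (H b \<union> (fst (f b) \<union> snd (f b))) = {})"
      for f :: "'k \<Rightarrow> 'a set \<times> 'a set" and c p
    have "\<exists>f. \<forall>c. good f c (f c)"
    proof (rule dependent_wf_choice[OF wf_before])
      show "good f c F = good g c F" if "\<And>b. (b, c) \<in> {(b, a). b \<in> before a} \<Longrightarrow> f b = g b" for f g c F
        using that by (auto simp: good_def)
      show "\<exists>p. good f c p" if IHf: "\<And>b. (b, c) \<in> {(b, a). b \<in> before a} \<Longrightarrow> good f b (f b)" for c f
      proof (cases "c \<in> before a")
        case c: True
        have f: "clopenin X (fst (f b) \<union> snd (f b))" "x \<notin> fst (f b) \<union> snd (f b)" if "b \<in> before c" for b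
          using IHf[of b] that before_trans[OF that c] unfolding good_def by (auto intro: clopenin_Un)
        let ?H = "\<lambda>b. H b \<union> (fst (f b) \<union> snd (f b))"
        have H': "clopenin Y (?H b)" if "b \<in> before c" for b
          using H[OF before_trans[OF that c]] clopenin_Y_if_clopenin[OF f[OF that]] by (rule clopenin_Un)
        \<comment> \<open>The sets chosen earlier are far, so enlarging the \<open>H b\<close> by
          them does not help to cover \<open>Y\<close>: the finite set of indices given by the
          induction hypothesis at \<open>c\<close> would still work for the original
          \<open>H b\<close>, against \<open>no_fin\<close>.\<close>
        have "\<not> topspace Y \<subseteq> S \<union> (\<Union>b\<in>before c. ?H b)"
        proof
          assume "topspace Y \<subseteq> S \<union> (\<Union>b\<in>before c. ?H b)"
          then obtain T where T: "T \<subseteq> before c" "finite T" "far (topspace Y - S - (\<Union>b\<in>T. ?H b))"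
            using IH[OF c S, of ?H] H' by blast
          have "far (\<Union>b\<in>T. fst (f b) \<union> snd (f b))"
            using T f by (intro far_UN far_clopenin) auto
          then have "far ((topspace Y - S - (\<Union>b\<in>T. ?H b)) \<union> (\<Union>b\<in>T. fst (f b) \<union> snd (f b)))"
            using T(3) far_Un by blast
          then have "far (topspace Y - S - (\<Union>b\<in>T. H b))"
            by (rule far_subset) blast
          moreover have "T \<subseteq> before a"
            using T(1) c before_trans by blast
          ultimately show False
            using no_fin T(2) by blast
        qed
        then obtain q where q: "q \<in> topspace Y - S" "\<And>b. b \<in> before c \<Longrightarrow> q \<notin> ?H b"
          by blast
        have op: "openin X (topspace Y - S)"
          using S by (intro openin_X_if_openin_Y openin_diff) (simp_all only: clopenin_def openin_topspace)
        have "q \<noteq> x" and Hq: "\<And>b. b \<in> before c \<Longrightarrow> clopenin Y (?H b) \<and> q \<notin> ?H b"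
          using q H' by auto
        obtain P where P: "clopenin X P" "P \<noteq> {}" "x \<notin> P" "P \<subseteq> topspace Y - S" "\<forall>b\<in>before c. P \<inter> ?H b = {}"
          by (rule ex_clopen_avoiding[OF op q(1) \<open>q \<noteq> x\<close> before_small Hq])
        obtain Q R where QR: "clopenin X Q" "clopenin X R" "Q \<noteq> {}" "R \<noteq> {}" "Q \<inter> R = {}" "Q \<subseteq> P" "R \<subseteq> P"
          by (rule split_clopen[OF P(1,2)])
        then have "good f c (Q, R)"
          unfolding good_def fst_conv snd_conv using P(3-5) by (intro impI conjI ballI) blast+
        then show ?thesis
          by blast
      qed (simp add: good_def)
    qed
    then obtain f where f: "\<And>c. good f c (f c)"
      by blast
    define P where "P c = fst (f c)" for c
    define Q where "Q c = snd (f c)" for c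
    have PQ: "clopenin X (P c)" "clopenin X (Q c)" "x \<notin> P c" "x \<notin> Q c" "P c \<noteq> {}" "Q c \<noteq> {}" "P c \<inter> Q c = {}"
      "P c \<inter> S = {}" "Q c \<inter> S = {}" if "c \<in> before a" for c
      using f[of c] that unfolding good_def P_def Q_def by auto
    have avoid: "P c \<inter> H b = {}" "Q c \<inter> H b = {}" "P c \<inter> Q b = {}" "Q c \<inter> P b = {}" 
      if "c \<in> before a" "b \<in> before c" for b c
      using f[of c] that unfolding good_def P_def Q_def by blast+
    have "(\<Union>c\<in>before a. P c) \<inter> (\<Union>c\<in>before a. Q c) = {}"
    proof -
      have "P c \<inter> Q d = {}" if "c \<in> before a" "d \<in> before a" for c d
        using before_cases[OF before_in before_in, OF that] PQ(7)[of c] avoid(3)[of c d] avoid(4)[of d c] that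
        by blast
      then show ?thesis
        by blast
    qed
    moreover have "type_less X (\<Union>c\<in>before a. P c) K" "type_less X (\<Union>c\<in>before a. Q c) K"
      using PQ(1,2) by (auto intro!: type_less_UN before_small)
    ultimately have PQ_far: "far (\<Union>c\<in>before a. P c) \<or> far (\<Union>c\<in>before a. Q c)"
      using PQ(3,4) by (intro far_or_far_if_disjoint) auto
    have not_far: "\<not> far (\<Union>c\<in>before a. N c)"
      if N: "\<And>c. c \<in> before a \<Longrightarrow> N c \<noteq> {} \<and> N c \<inter> S = {}" 
        "\<And>c b. \<lbrakk>c \<in> before a; b \<in> before c\<rbrakk> \<Longrightarrow> N c \<inter> H b = {}" for N
    proof
      assume "far (\<Union>c\<in>before a. N c)"
      then obtain d where d: "d \<in> K" "(\<Union>c\<in>before a. N c) \<subseteq> C d"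
        by (auto simp: far_def)
      have cpt: "compactin X (C d)"
        using C[OF d(1)] compact closedin_compact_space by (auto simp: clopenin_def)
      have op: "openin X V" if "V \<in> insert S (H ` before a)" for V
        using that S H openin_X_if_openin_Y by (auto simp: clopenin_def)
      have cov: "C d \<subseteq> \<Union>(insert S (H ` before a))"
        using cover C_subset[OF d(1)] by auto
      have "\<exists>\<F>. finite \<F> \<and> \<F> \<subseteq> insert S (H ` before a) \<and> C d \<subseteq> \<Union>\<F>"
        by (rule compactinD[OF cpt op cov])
      then obtain \<F> where \<F>: "finite \<F>" "\<F> \<subseteq> insert S (H ` before a)" "C d \<subseteq> \<Union>\<F>"
        by (elim exE conjE)
      then have "finite (\<F> - {S})" "\<F> - {S} \<subseteq> H ` before a"
        by auto
      then obtain T where T: "T \<subseteq> before a" "finite T" "\<F> - {S} = H ` T"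
        using finite_subset_image[of "\<F> - {S}" H "before a"] by blast
      \<comment> \<open>As \<open>a\<close> is a limit, some \<open>c\<close> lies above the
        finitely many indices in \<open>T\<close>. Then \<open>N c\<close> is non-empty, avoids
        \<open>S\<close> and the \<open>H b\<close> with \<open>b\<close> in \<open>T\<close>, and
        yet lies in \<open>C d\<close>, which they cover.\<close>
      obtain c where c: "c \<in> before a" "T \<subseteq> before c"
        using limit_fin[OF T(2,1)] by (elim bexE)
      obtain q where "q \<in> N c"
        using N(1)[OF c(1)] by blast
      then have "q \<in> C d" "q \<notin> S" "\<And>b. b \<in> T \<Longrightarrow> q \<notin> H b"
        using d(2) c N(1)[OF c(1)] N(2)[OF c(1)] by blast+
      then show False
        using \<F>(3) T(3) by blast
    qed
    have "\<not> far (\<Union>c\<in>before a. P c)" "\<not> far (\<Union>c\<in>before a. Q c)"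
      by (rule not_far; simp add: PQ avoid)+
    then show False
      using PQ_far by simp
  qed
qed

lemma finite_subcover_small:
  assumes I: "I \<prec> K" and H: "\<And>i. i \<in> I \<Longrightarrow> clopenin Y (H i)" and cover: "topspace Y \<subseteq> (\<Union>i\<in>I. H i)"
  obtains T where "T \<subseteq> I" "finite T" "far (topspace Y - (\<Union>i\<in>T. H i))"
proof -
  obtain a f where a: "a \<in> K" "H ` I \<subseteq> f ` before a" "f ` before a \<subseteq> insert {} (H ` I)"
    by (rule small_eq_image_before[OF small_image[OF I], where d = "{}"])
  have "clopenin Y (f b)" if "b \<in> before a" for b
    using a(3) that H by (auto simp: image_subset_iff)
  moreover have "topspace Y \<subseteq> {} \<union> (\<Union>b\<in>before a. f b)"
    using cover a(2) by auto
  ultimately obtain T where T: "T \<subseteq> before a" "finite T" "far (topspace Y - {} - (\<Union>b\<in>T. f b))"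
    using finite_subcover_before[OF a(1), of "{}" f] by auto
  have "f ` T - {{}} \<subseteq> H ` I" "finite (f ` T - {{}})"
    using T a(3) by auto
  then obtain T' where T': "T' \<subseteq> I" "finite T'" "f ` T - {{}} = H ` T'"
    using finite_subset_image[of "f ` T - {{}}" H I] by blast
  have "(\<Union>b\<in>T. f b) = (\<Union>i\<in>T'. H i)"
    using T'(3) by blast
  then show thesis
    using that[OF T'(1,2)] T(3) by simp
qed

section \<open>Tame sets, sparse sequences and pseudointersections\<close>

lemma before_or_le: "\<lbrakk>a \<in> K; b \<in> K\<rbrakk> \<Longrightarrow> a \<in> insert b (before b) \<or> b \<in> before a"
  using before_cases by blast

lemma type_less_Int_U: "clopenin Y V \<Longrightarrow> type_less X (V \<inter> U c) K"
proof -
  assume V: "clopenin Y V"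
  have "V \<inter> U c = (\<Union>b\<in>before c. V \<inter> C b)"
    unfolding U_def by blast
  then show ?thesis
    using type_less_UN[OF before_small, of c "\<lambda>b. V \<inter> C b"] clopenin_X_Int[OF V] C before_in by simp
qed

lemma x_notin_Int_U: "x \<notin> V \<inter> U c"
  using U_subset by auto

lemma not_far_topspace: "\<not> far (topspace Y)"
proof
  assume "far (topspace Y)"
  then obtain a where a: "a \<in> K" "topspace Y \<subseteq> C a"
    by (auto simp: far_def)
  then have "topspace X - C a = {x}"
    using C_subset[OF a(1)] x_in by auto
  then show False
    using C[OF a(1)] not_isolated[of x] x_in openin_diff[of X "topspace X" "C a"]
    by (auto simp: isolated_point_def clopenin_def)
qed

definition tame :: "'a set \<Rightarrow> bool" where
  "tame Z \<longleftrightarrow> (\<forall>c\<in>K. far (Z \<inter> U c))"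

lemma tame_subset: "\<lbrakk>tame Z; Z' \<subseteq> Z\<rbrakk> \<Longrightarrow> tame Z'"
  unfolding tame_def using far_subset by (meson Int_mono subset_refl)

lemma tame_or_tame_if_disjoint:
  assumes "clopenin Y V" "clopenin Y W" "V \<inter> W = {}"
  shows "tame V \<or> tame W"
proof (rule ccontr)
  assume "\<not> ?thesis"
  then obtain c d where "\<not> far (V \<inter> U c)" "\<not> far (W \<inter> U d)"
    by (auto simp: tame_def)
  moreover have "far (V \<inter> U c) \<or> far (W \<inter> U d)"
    by (rule far_or_far_if_disjoint) (use assms type_less_Int_U x_notin_Int_U in blast)+
  ultimately show False
    by simp
qed

text \<open>Disjointness from the earlier \<open>C b\<close> lets the sequence leave every compact
  subset of \<open>Y\<close>. It makes every subfamily locally small in the sense of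
  \<open>separate_locally_small\<close>, and keeps the union of a cofinal subfamily from being
  far.\<close>

definition sparse :: "('k \<Rightarrow> 'a set) \<Rightarrow> bool" where
  "sparse P \<longleftrightarrow> (\<forall>a\<in>K. clopenin X (P a) \<and> P a \<noteq> {} \<and> x \<notin> P a \<and>
     (\<forall>b\<in>before a. P a \<inter> C b = {} \<and> P a \<inter> P b = {}))"

lemma ex_sparse:
  assumes D: "\<And>a. a \<in> K \<Longrightarrow> clopenin Y (D a)"
    and centered: "\<And>T. \<lbrakk>T \<subseteq> K; finite T\<rbrakk> \<Longrightarrow> \<not> far (topspace Y \<inter> (\<Inter>a\<in>T. D a))"
  obtains P where "sparse P" "\<And>a b. \<lbrakk>a \<in> K; b \<in> insert a (before a)\<rbrakk> \<Longrightarrow> P a \<subseteq> D b"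
proof -
  define good where "good f a P \<longleftrightarrow> a \<in> K \<longrightarrow> clopenin X P \<and> P \<noteq> {} \<and> x \<notin> P \<and> P \<subseteq> D a \<and>
      (\<forall>b\<in>before a. P \<subseteq> D b \<and> P \<inter> C b = {} \<and> P \<inter> f b = {})"
    for f :: "'k \<Rightarrow> 'a set" and a P
  have "\<exists>f. \<forall>a. good f a (f a)"
  proof (rule dependent_wf_choice[OF wf_before])
    show "good f a F = good g a F" if "\<And>b. (b, a) \<in> {(b, a). b \<in> before a} \<Longrightarrow> f b = g b" for f g a F
      using that by (auto simp: good_def)
    show "\<exists>P. good f a P" if IHf: "\<And>b. (b, a) \<in> {(b, a). b \<in> before a} \<Longrightarrow> good f b (f b)" for a f
    proof (cases "a \<in> K")
      case a: True
      have f: "clopenin X (C b \<union> f b)" "x \<notin> C b \<union> f b" if "b \<in> before a" for b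
        using IHf[of b] that before_in[OF that] C unfolding good_def by (auto intro: clopenin_Un)
      \<comment> \<open>The index \<open>a\<close> contributes only the complement of
        \<open>D a\<close>, since just the earlier \<open>C b\<close> and \<open>f b\<close> have to
        be avoided. If the \<open>H b\<close> covered \<open>Y\<close>, finitely many would do so up
        to a far set; dropping the far sets \<open>C b \<union> f b\<close> would leave a finite
        intersection of the \<open>D b\<close> that is far.\<close>
      define H where "H b = (topspace Y - D b) \<union> (if b = a then {} else C b \<union> f b)" for b
      have H: "clopenin Y (H b)" if "b \<in> insert a (before a)" for b
        unfolding H_def using that f clopenin_Y_if_clopenin[of "C b \<union> f b"] D[of b] a before_in[of b a]
        by (intro clopenin_Un clopenin_Diff clopenin_topspace) auto
      have "\<not> topspace Y \<subseteq> (\<Union>b\<in>insert a (before a). H b)"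
      proof
        assume cover: "topspace Y \<subseteq> (\<Union>b\<in>insert a (before a). H b)"
        obtain T where T: "T \<subseteq> insert a (before a)" "finite T" "far (topspace Y - (\<Union>b\<in>T. H b))"
          by (rule finite_subcover_small[OF small_insert_before H cover])
        have "far (\<Union>b\<in>T - {a}. C b \<union> f b)"
          using T f by (intro far_UN far_clopenin) auto
        then have "far ((topspace Y - (\<Union>b\<in>T. H b)) \<union> (\<Union>b\<in>T - {a}. C b \<union> f b))"
          using T(3) far_Un by simp
        then have "far (topspace Y \<inter> (\<Inter>b\<in>T. D b))"
          by (rule far_subset) (auto simp: H_def split: if_splits)
        moreover have "T \<subseteq> K"
          using T(1) a before_subset by blast
        ultimately show False
          using centered[OF _ T(2)] by simp
      qed
      then obtain q where q: "q \<in> topspace Y" "\<And>b. b \<in> insert a (before a) \<Longrightarrow> q \<notin> H b"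
        by blast
      have op: "openin X (topspace Y)"
        by (rule openin_X_if_openin_Y) (rule openin_topspace)
      have "q \<noteq> x" and Hq: "\<And>b. b \<in> insert a (before a) \<Longrightarrow> clopenin Y (H b) \<and> q \<notin> H b"
        using q H by auto
      obtain P where P: "clopenin X P" "P \<noteq> {}" "x \<notin> P" "P \<subseteq> topspace Y" "\<forall>b\<in>insert a (before a). P \<inter> H b = {}"
        by (rule ex_clopen_avoiding[OF op q(1) \<open>q \<noteq> x\<close> small_insert_before Hq])
      have "P \<subseteq> D b" if "b \<in> insert a (before a)" for b
        using P(4,5) that unfolding H_def by blast
      moreover have "P \<inter> C b = {} \<and> P \<inter> f b = {}" if "b \<in> before a" for b
      proof -
        have "b \<noteq> a"
          using that before_irrefl by blast
        moreover have "P \<inter> H b = {}"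
          using P(5) that by simp
        ultimately show ?thesis
          unfolding H_def by auto
      qed
      ultimately have "good f a P"
        unfolding good_def using P(1-3) by simp
      then show ?thesis
        by blast
    qed (simp add: good_def)
  qed
  then obtain f where f: "\<And>a. good f a (f a)"
    by blast
  have "sparse f"
    unfolding sparse_def using f unfolding good_def by simp
  moreover have "f a \<subseteq> D b" if "a \<in> K" "b \<in> insert a (before a)" for a b
    using f[of a] that unfolding good_def by auto
  ultimately show thesis
    by (rule that)
qed

text \<open>\<open>P i\<close> meets \<open>C a\<close> only for \<open>i\<close> at most
  \<open>a\<close>, so the two parts of any partition of the sequence are locally small and can be
  separated.\<close>

lemma sparse_select:
  assumes P: "sparse P" and S: "S \<subseteq> K"
  obtains E where "clopenin Y E" "\<forall>a\<in>S. P a \<subseteq> E" "\<forall>a\<in>K - S. E \<inter> P a = {}"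
proof (rule separate_locally_small[of S P "K - S" P])
  have P1: "clopenin X (P a)" "x \<notin> P a" "\<And>b. b \<in> before a \<Longrightarrow> P a \<inter> C b = {} \<and> P a \<inter> P b = {}"
    if "a \<in> K" for a
    using P that unfolding sparse_def by auto
  show "clopenin Y (P a)" if "a \<in> S" for a
    using P1[of a] that S clopenin_Y_if_clopenin by auto
  show "clopenin Y (P a)" if "a \<in> K - S" for a
    using P1[of a] that clopenin_Y_if_clopenin by auto
  have small: "{i \<in> K. P i \<inter> C a \<noteq> {}} \<prec> K" if "a \<in> K" for a
  proof (rule small_subset[OF small_insert_before])
    show "{i \<in> K. P i \<inter> C a \<noteq> {}} \<subseteq> insert a (before a)"
      using before_or_le that P1(3) by blast
  qed
  show "{i \<in> S. P i \<inter> C a \<noteq> {}} \<prec> K" "{i \<in> K - S. P i \<inter> C a \<noteq> {}} \<prec> K" if "a \<in> K" for a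
    by (rule small_subset[OF small[OF that]]; use S in blast)+
  show "P i \<inter> P j = {}" if "i \<in> S" "j \<in> K - S" for i j
    using before_cases[of i j] P1(3)[of i j] P1(3)[of j i] that S by blast
qed (rule that)

lemma sparse_not_far:
  assumes P: "sparse P" and S: "S \<subseteq> K" "\<And>c. c \<in> K \<Longrightarrow> \<exists>a\<in>S. c \<in> before a" and E: "\<And>a. a \<in> S \<Longrightarrow> P a \<subseteq> E"
  shows "\<not> far E"
proof
  assume "far E"
  then obtain c where c: "c \<in> K" "E \<subseteq> C c"
    by (auto simp: far_def)
  then obtain a where a: "a \<in> S" "c \<in> before a"
    using S by blast
  then have "P a \<inter> C c = {}" "P a \<noteq> {}"
    using P S(1) by (auto simp: sparse_def)
  then show False
    using E[OF a(1)] c by blast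
qed

text \<open>Two disjoint cofinal subsequences are put on different sides of a clopen set; this set
  or its complement is tame, so one of the subsequences lies in a tame set.\<close>

lemma sparse_tame_part:
  assumes P: "sparse P"
  obtains Z S where "clopenin Y Z" "tame Z" "S \<subseteq> K" "\<And>c. c \<in> K \<Longrightarrow> \<exists>a\<in>S. c \<in> before a"
    "\<And>a. a \<in> S \<Longrightarrow> P a \<subseteq> Z"
proof -
  obtain \<pi> where \<pi>: "\<And>i c. \<lbrakk>i \<in> K; c \<in> K\<rbrakk> \<Longrightarrow> \<exists>a\<in>K. \<pi> a = i \<and> c \<in> before a"
    using unbounded_fibres by metis
  obtain i where i: "i \<in> K"
    using infinite_K by (metis finite.emptyI ex_in_conv)
  obtain j where j: "j \<in> K" "j \<noteq> i"
    using exists_above[OF i] before_irrefl by metis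
  let ?S = "\<lambda>i. {a \<in> K. \<pi> a = i}"
  obtain E where E: "clopenin Y E" "\<forall>a\<in>?S i. P a \<subseteq> E" "\<forall>a\<in>K - ?S i. E \<inter> P a = {}"
    by (rule sparse_select[OF P, of "?S i"]) auto
  have fibre: "\<exists>a\<in>?S k. c \<in> before a" if "k \<in> K" "c \<in> K" for k c
    using \<pi>[OF that] by blast
  have "P a \<subseteq> topspace Y - E" if "a \<in> ?S j" for a
  proof -
    have "clopenin X (P a)" "x \<notin> P a" "E \<inter> P a = {}"
      using that j(2) P E(3) by (auto simp: sparse_def)
    then show ?thesis
      using clopenin_subset[of X "P a"] by auto
  qed
  moreover have "tame E \<or> tame (topspace Y - E)"
    by (rule tame_or_tame_if_disjoint[OF E(1) clopenin_Diff[OF clopenin_topspace E(1)]]) blast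
  moreover have "clopenin Y (topspace Y - E)"
    by (rule clopenin_Diff[OF clopenin_topspace E(1)])
  ultimately show thesis
    using that[of E "?S i"] that[of "topspace Y - E" "?S j"] E(1,2) i j(1) fibre by blast
qed

text \<open>\<open>E\<close> collects a cofinal part of a sparse sequence whose members after
  \<open>a\<close> lie in \<open>D a\<close>, and is kept off \<open>Z - D a\<close> up to a far
  set. Only the members up to \<open>a\<close> stand in the way, and inside the tame set
  \<open>Z\<close> their union is far.\<close>

lemma ex_pseudointersection:
  assumes D: "\<And>a. a \<in> K \<Longrightarrow> clopenin Y (D a)"
    and centered: "\<And>T. \<lbrakk>T \<subseteq> K; finite T\<rbrakk> \<Longrightarrow> \<not> far (topspace Y \<inter> (\<Inter>a\<in>T. D a))"
  obtains E where "clopenin Y E" "\<not> far E" "\<And>a. a \<in> K \<Longrightarrow> far (E - D a)"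
proof -
  obtain P where P: "sparse P" and PD: "\<And>a b. \<lbrakk>a \<in> K; b \<in> insert a (before a)\<rbrakk> \<Longrightarrow> P a \<subseteq> D b"
    by (rule ex_sparse[of D]) (use D centered in auto)
  obtain Z S where Z: "clopenin Y Z" "tame Z" "S \<subseteq> K" "\<And>c. c \<in> K \<Longrightarrow> \<exists>a\<in>S. c \<in> before a"
    "\<And>a. a \<in> S \<Longrightarrow> P a \<subseteq> Z"
    by (rule sparse_tame_part[OF P]) auto
  have P1: "clopenin X (P a)" "x \<notin> P a" "\<And>b. b \<in> before a \<Longrightarrow> P a \<inter> C b = {}" if "a \<in> K" for a
    using P that unfolding sparse_def by auto
  \<comment> \<open>\<open>C (m a)\<close> has two duties: containing \<open>Z \<inter> U a\<close>,
    it makes the sets \<open>B a\<close> locally small; containing the part in \<open>Z\<close> of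
    each \<open>P b\<close> with \<open>b\<close> at most \<open>a\<close>, it makes
    \<open>B a\<close> disjoint from the selected ones among them.\<close>
  have "\<exists>m\<in>K. Z \<inter> (U a \<union> (\<Union>b\<in>insert a (before a). P b)) \<subseteq> C m" if a: "a \<in> K" for a
  proof -
    have "far (P b)" if "b \<in> insert a (before a)" for b
      using that a before_in[of b a] by (intro far_clopenin P1) auto
    then obtain a' where a': "a' \<in> K" "(\<Union>b\<in>insert a (before a). P b) \<subseteq> U a'"
      using far_small_subset_U[OF small_insert_before[of a], of P] by blast
    obtain c where c: "c \<in> K" "a \<in> before c" "a' \<in> before c"
      using exists_above2[OF a a'(1)] by blast
    have "U a \<union> (\<Union>b\<in>insert a (before a). P b) \<subseteq> U c"
      using a'(2) U_mono[OF c(2)] U_mono[OF c(3)] by blast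
    then have "Z \<inter> (U a \<union> (\<Union>b\<in>insert a (before a). P b)) \<subseteq> Z \<inter> U c"
      by blast
    moreover have "far (Z \<inter> U c)"
      using Z(2) c(1) by (simp add: tame_def)
    ultimately show ?thesis
      using far_subset unfolding far_def by metis
  qed
  then obtain m where m: "\<And>a. a \<in> K \<Longrightarrow> m a \<in> K"
      "\<And>a. a \<in> K \<Longrightarrow> Z \<inter> (U a \<union> (\<Union>b\<in>insert a (before a). P b)) \<subseteq> C (m a)"
    by metis
  define B where "B a = Z - D a - C (m a)" for a
  obtain E where E: "clopenin Y E" "\<forall>i\<in>S. P i \<subseteq> E" "\<forall>j\<in>K. E \<inter> B j = {}"
  proof (rule separate_locally_small[of S P K B])
    show "clopenin Y (P i)" if "i \<in> S" for i
      using P1[of i] that Z(3) clopenin_Y_if_clopenin by auto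
    show "clopenin Y (B j)" if "j \<in> K" for j
      unfolding B_def using Z(1) D[OF that] C[OF m(1)[OF that]] clopenin_Y_if_clopenin
      by (intro clopenin_Diff) auto
    show "{i \<in> S. P i \<inter> C a \<noteq> {}} \<prec> K" if "a \<in> K" for a
    proof (rule small_subset[OF small_insert_before])
      show "{i \<in> S. P i \<inter> C a \<noteq> {}} \<subseteq> insert a (before a)"
        using before_or_le that P1(3) Z(3) by blast
    qed
    show "{j \<in> K. B j \<inter> C a \<noteq> {}} \<prec> K" if "a \<in> K" for a
    proof (rule small_subset[OF small_insert_before])
      have "B j \<inter> C a = {}" if "j \<in> K" "a \<in> before j" for j
        using m(2)[OF that(1)] C_subset_U[OF that(2)] unfolding B_def by blast
      then show "{j \<in> K. B j \<inter> C a \<noteq> {}} \<subseteq> insert a (before a)"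
        using before_or_le that by blast
    qed
    show "P i \<inter> B j = {}" if "i \<in> S" "j \<in> K" for i j
    proof (cases "i \<in> insert j (before j)")
      case True
      then have "P i \<subseteq> C (m j)"
        using m(2)[OF that(2)] Z(5)[OF that(1)] by blast
      then show ?thesis
        unfolding B_def by blast
    next
      case False
      then have "P i \<subseteq> D j"
        using before_or_le[of i j] that Z(3) PD[of i j] by blast
      then show ?thesis
        unfolding B_def by blast
    qed
  qed auto
  show thesis
  proof (rule that[of "E \<inter> Z"])
    show "clopenin Y (E \<inter> Z)"
      using E(1) Z(1) by (rule clopenin_Int)
    show "\<not> far (E \<inter> Z)"
      by (rule sparse_not_far[OF P Z(3)]) (use E(2) Z(4,5) in auto)
    show "far (E \<inter> Z - D a)" if "a \<in> K" for a
    proof (rule far_subset[OF far_C[OF m(1)[OF that]]])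
      show "E \<inter> Z - D a \<subseteq> C (m a)"
        using E(3) that unfolding B_def by blast
    qed
  qed
qed

text \<open>Two disjoint cofinal subsequences of one sparse sequence inside \<open>D\<close> are put
  on different sides of \<open>E\<close>. This excludes isolated points of the remainder.\<close>

lemma ex_split:
  assumes D: "clopenin Y D" "\<not> far D"
  obtains E where "clopenin Y E" "\<not> far (D \<inter> E)" "\<not> far (D - E)"
proof -
  have "\<not> far (topspace Y \<inter> (\<Inter>a\<in>T. D))" for T :: "'k set"
    using D clopenin_subset[OF D(1)] not_far_topspace by (cases "T = {}") (auto simp: Int_absorb1)
  then obtain P where P: "sparse P" and PD: "\<And>a b. \<lbrakk>a \<in> K; b \<in> insert a (before a)\<rbrakk> \<Longrightarrow> P a \<subseteq> D"
    by (rule ex_sparse[of "\<lambda>_. D", OF D(1)]) auto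
  obtain \<pi> where \<pi>: "\<And>i c. \<lbrakk>i \<in> K; c \<in> K\<rbrakk> \<Longrightarrow> \<exists>a\<in>K. \<pi> a = i \<and> c \<in> before a"
    using unbounded_fibres by metis
  obtain i where i: "i \<in> K"
    using infinite_K by (metis finite.emptyI ex_in_conv)
  obtain j where j: "j \<in> K" "j \<noteq> i"
    using exists_above[OF i] before_irrefl by metis
  let ?S = "\<lambda>i. {a \<in> K. \<pi> a = i}"
  obtain E where E: "clopenin Y E" "\<forall>a\<in>?S i. P a \<subseteq> E" "\<forall>a\<in>K - ?S i. E \<inter> P a = {}"
    by (rule sparse_select[OF P, of "?S i"]) auto
  have fibre: "\<exists>a\<in>?S k. c \<in> before a" if "k \<in> K" "c \<in> K" for k c
    using \<pi>[OF that] by blast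
  have "\<not> far (D \<inter> E)"
    by (rule sparse_not_far[OF P, of "?S i"]) (use E(2) PD fibre[OF i] in blast)+
  moreover have "\<not> far (D - E)"
    by (rule sparse_not_far[OF P, of "?S j"]) (use E(3) PD fibre[OF j(1)] j(2) in blast)+
  ultimately show thesis
    using that E(1) by simp
qed

text \<open>A sparse sequence is cut into kappa many cofinal pieces, and \<open>E S\<close> selects
  the pieces labelled by \<open>S\<close>. A label in \<open>S\<close> but not in \<open>T\<close>
  leaves a whole cofinal piece in \<open>E S - E T\<close>, so the 2^kappa many sets have distinct
  traces on the remainder.\<close>

lemma ex_many_clopens:
  obtains E where "\<And>S. S \<subseteq> K \<Longrightarrow> clopenin Y (E S)"
    "\<And>S T. \<lbrakk>S \<subseteq> K; T \<subseteq> K; \<not> S \<subseteq> T\<rbrakk> \<Longrightarrow> \<not> far (E S - E T)"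
proof -
  have "\<not> far (topspace Y \<inter> (\<Inter>a\<in>T. topspace Y))" for T :: "'k set"
    using not_far_topspace by (cases "T = {}") auto
  then obtain P where P: "sparse P"
    by (rule ex_sparse[of "\<lambda>_. topspace Y", OF clopenin_topspace]) auto
  obtain \<pi> where \<pi>: "\<And>i c. \<lbrakk>i \<in> K; c \<in> K\<rbrakk> \<Longrightarrow> \<exists>a\<in>K. \<pi> a = i \<and> c \<in> before a"
    using unbounded_fibres by metis
  have "\<exists>E. clopenin Y E \<and> (\<forall>a\<in>K. if \<pi> a \<in> S then P a \<subseteq> E else E \<inter> P a = {})" for S
  proof -
    obtain E where E: "clopenin Y E" "\<forall>a\<in>{a \<in> K. \<pi> a \<in> S}. P a \<subseteq> E"
        "\<forall>a\<in>K - {a \<in> K. \<pi> a \<in> S}. E \<inter> P a = {}"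
      by (rule sparse_select[OF P, of "{a \<in> K. \<pi> a \<in> S}"]) auto
    then show ?thesis
      by (intro exI[of _ E]) auto
  qed
  then obtain E where E: "\<And>S. clopenin Y (E S)" "\<And>S a. a \<in> K \<Longrightarrow> if \<pi> a \<in> S then P a \<subseteq> E S else E S \<inter> P a = {}"
    by metis
  show thesis
  proof (rule that[of E])
    fix S T assume "S \<subseteq> K" "T \<subseteq> K" "\<not> S \<subseteq> T"
    then obtain i where i: "i \<in> K" "i \<in> S" "i \<notin> T"
      by blast
    show "\<not> far (E S - E T)"
    proof (rule sparse_not_far[OF P, of "{a \<in> K. \<pi> a = i}"])
      show "P a \<subseteq> E S - E T" if "a \<in> {a \<in> K. \<pi> a = i}" for a
        using E(2)[of a S] E(2)[of a T] that i by auto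
    qed (use \<pi>[OF i(1)] in auto)
  qed (rule E(1))
qed

section \<open>Separation of orthogonal families\<close>

lemma tameD: "\<lbrakk>tame Z; c \<in> K\<rbrakk> \<Longrightarrow> far (Z \<inter> U c)"
  by (simp add: tame_def)

text \<open>Thinning each \<open>A a\<close> by a far part makes the whole union tame: the union with one choice of
  removed parts, if not tame, accumulates at \<open>x\<close> already within some \<open>U d\<close>;
  removing also \<open>U d\<close> from every \<open>A a\<close> leaves a union that is disjoint from this
  piece, so it cannot accumulate at \<open>x\<close> within any \<open>U c\<close>.\<close>

lemma ex_tame_thinning:
  assumes A: "\<And>a. a \<in> K \<Longrightarrow> clopenin Y (A a) \<and> tame (A a)"
    and h: "\<And>a. a \<in> K \<Longrightarrow> h a \<in> K"
  obtains M where "\<forall>a\<in>K. clopenin X (M a) \<and> x \<notin> M a \<and> A a \<inter> U (h a) \<subseteq> M a"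
    "tame (\<Union>a\<in>K. A a - M a)"
proof -
  have "\<exists>m\<in>K. A a \<inter> U c \<subseteq> C m" if "a \<in> K" "c \<in> K" for a c
    using A[OF that(1)] that(2) by (simp add: tame_def far_def)
  then obtain m where m: "\<And>a c. \<lbrakk>a \<in> K; c \<in> K\<rbrakk> \<Longrightarrow> m a c \<in> K"
      "\<And>a c. \<lbrakk>a \<in> K; c \<in> K\<rbrakk> \<Longrightarrow> A a \<inter> U c \<subseteq> C (m a c)"
    by metis
  define W where "W g = (\<Union>a\<in>K. A a - C (m a (g a)))" for g
  \<comment> \<open>The condition \<open>U a \<subseteq> U (g a)\<close> makes the thinned
    \<open>A a\<close> miss \<open>C b\<close> for all \<open>b\<close> before \<open>a\<close>.
    Hence only indices \<open>a\<close> before \<open>c\<close> contribute to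
    \<open>W g \<inter> U c\<close>, which therefore has type below kappa.\<close>
  define good where "good g \<longleftrightarrow> (\<forall>a\<in>K. g a \<in> K \<and> U a \<subseteq> U (g a) \<and> U (h a) \<subseteq> U (g a))" for g
  have type_W: "type_less X (W g \<inter> U c) K" if g: "good g" and c: "c \<in> K" for g c
  proof -
    have g': "g a \<in> K" "U a \<subseteq> U (g a)" if "a \<in> K" for a
      using g that by (auto simp: good_def)
    have "W g \<inter> U c = (\<Union>(a, b)\<in>before c \<times> before c. (A a - C (m a (g a))) \<inter> C b)"
    proof
      show "W g \<inter> U c \<subseteq> (\<Union>(a, b)\<in>before c \<times> before c. (A a - C (m a (g a))) \<inter> C b)"
      proof
        fix p assume "p \<in> W g \<inter> U c"
        then obtain a b where ab: "a \<in> K" "p \<in> A a" "p \<notin> C (m a (g a))" "b \<in> before c" "p \<in> C b"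
          unfolding W_def U_def by blast
        have "b \<notin> before a"
        proof
          assume "b \<in> before a"
          then have "p \<in> U (g a)"
            using C_subset_U g'(2)[OF ab(1)] ab(5) by blast
          then show False
            using m(2)[OF ab(1) g'(1)[OF ab(1)]] ab(2,3) by blast
        qed
        then have "a \<in> insert b (before b)"
          using before_or_le[OF ab(1) before_in[OF ab(4)]] by blast
        then have "a \<in> before c"
          using ab(4) before_trans by blast
        then show "p \<in> (\<Union>(a, b)\<in>before c \<times> before c. (A a - C (m a (g a))) \<inter> C b)"
          using ab by blast
      qed
      show "(\<Union>(a, b)\<in>before c \<times> before c. (A a - C (m a (g a))) \<inter> C b) \<subseteq> W g \<inter> U c"
        unfolding W_def U_def using before_in by blast
    qed
    moreover have "clopenin X (case i of (a, b) \<Rightarrow> (A a - C (m a (g a))) \<inter> C b)" if i: "i \<in> before c \<times> before c" for i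
    proof -
      obtain a b where ab: "i = (a, b)" "a \<in> K" "b \<in> K"
        using i before_in by blast
      have "clopenin Y (C (m a (g a)))"
        using C[OF m(1)[OF ab(2) g'(1)[OF ab(2)]]] clopenin_Y_if_clopenin by blast
      then show ?thesis
        using A[OF ab(2)] C[OF ab(3)] ab(1) by (auto intro!: clopenin_X_Int clopenin_Diff)
    qed
    ultimately show ?thesis
      using type_less_UN[OF small_Times[OF before_small before_small]] by simp
  qed
  have "\<exists>g. good g \<and> tame (W g)"
  proof -
    have "\<exists>c\<in>K. U a \<subseteq> U c \<and> U (h a) \<subseteq> U c" if "a \<in> K" for a
      using exists_above2[OF that h[OF that]] U_mono by metis
    then obtain g0 where g0: "good g0"
      unfolding good_def by metis
    show ?thesis
    proof (cases "tame (W g0)")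
      case False
      then obtain d where d: "d \<in> K" "\<not> far (W g0 \<inter> U d)"
        by (auto simp: tame_def)
      have "\<exists>c\<in>K. U (g0 a) \<subseteq> U c \<and> U d \<subseteq> U c" if "a \<in> K" for a
        using exists_above2[of "g0 a" d] U_mono d(1) g0 that unfolding good_def by metis
      then obtain g1 where g1: "\<And>a. a \<in> K \<Longrightarrow> g1 a \<in> K \<and> U (g0 a) \<subseteq> U (g1 a) \<and> U d \<subseteq> U (g1 a)"
        by metis
      have good: "good g1"
        using g0 g1 unfolding good_def by (meson order_trans)
      have disj: "W g1 \<inter> U d = {}"
        using m(2) g1 unfolding W_def by blast
      have "far (W g1 \<inter> U c)" if "c \<in> K" for c
      proof -
        have "far (W g0 \<inter> U d) \<or> far (W g1 \<inter> U c)"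
        proof (rule far_or_far_if_disjoint)
          show "type_less X (W g0 \<inter> U d) K" "type_less X (W g1 \<inter> U c) K"
            using type_W g0 good d(1) that by blast+
          show "W g0 \<inter> U d \<inter> (W g1 \<inter> U c) = {}"
            using disj by blast
        qed (rule x_notin_Int_U)+
        then show ?thesis
          using d(2) by simp
      qed
      then show ?thesis
        using good by (auto simp: tame_def)
    qed (use g0 in blast)
  qed
  then obtain g where g: "good g" "tame (W g)"
    by blast
  then have g': "g a \<in> K" "U (h a) \<subseteq> U (g a)" if "a \<in> K" for a
    using that by (auto simp: good_def)
  show thesis
  proof (rule that[of "\<lambda>a. C (m a (g a))"])
    show "\<forall>a\<in>K. clopenin X (C (m a (g a))) \<and> x \<notin> C (m a (g a)) \<and> A a \<inter> U (h a) \<subseteq> C (m a (g a))"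
    proof
      fix a assume a: "a \<in> K"
      show "clopenin X (C (m a (g a))) \<and> x \<notin> C (m a (g a)) \<and> A a \<inter> U (h a) \<subseteq> C (m a (g a))"
        using C[OF m(1)[OF a g'(1)[OF a]]] m(2)[OF a g'(1)[OF a]] g'(2)[OF a] by blast
    qed
    show "tame (\<Union>a\<in>K. A a - C (m a (g a)))"
      using g(2) by (simp add: W_def)
  qed
qed

lemma ex_bound_before:
  assumes "a \<in> K" and "\<And>b. b \<in> insert a (before a) \<Longrightarrow> far (V b)"
  shows "\<exists>c\<in>K. U a \<subseteq> U c \<and> (\<Union>b\<in>insert a (before a). V b) \<subseteq> U c"
proof -
  have "\<exists>d\<in>K. (\<Union>b\<in>insert a (before a). V b) \<subseteq> U d"
    by (rule far_small_subset_U[OF small_insert_before assms(2)])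
  then obtain d where d: "d \<in> K" "(\<Union>b\<in>insert a (before a). V b) \<subseteq> U d"
    by (elim bexE)
  obtain c where c: "c \<in> K" "a \<in> before c" "d \<in> before c"
    using exists_above2[OF assms(1) d(1)] by blast
  show ?thesis
    using c(1) U_mono[OF c(2)] U_mono[OF c(3)] d(2) by blast
qed

text \<open>The far intersections are removed according to the order of the indices:
  \<open>M a\<close> absorbs \<open>A a \<inter> B b\<close> for \<open>b\<close> at most
  \<open>a\<close>, and \<open>C (m b)\<close> absorbs what remains of
  \<open>A a \<inter> B b\<close> for \<open>a\<close> at most \<open>b\<close>. The trimmed
  families are disjoint and locally small, so they can be separated outright.\<close>

lemma separate_tame_families:
  assumes A: "\<And>a. a \<in> K \<Longrightarrow> clopenin Y (A a) \<and> tame (A a)" and B: "\<And>a. a \<in> K \<Longrightarrow> clopenin Y (B a) \<and> tame (B a)"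
    and far_Int: "\<And>a b. \<lbrakk>a \<in> K; b \<in> K\<rbrakk> \<Longrightarrow> far (A a \<inter> B b)"
  obtains E where "clopenin Y E" "\<forall>a\<in>K. far (A a - E)" "\<forall>b\<in>K. far (B b \<inter> E)"
proof -
  have "\<exists>c\<in>K. U a \<subseteq> U c \<and> (\<Union>b\<in>insert a (before a). A a \<inter> B b) \<subseteq> U c" if "a \<in> K" for a
    using that before_in by (intro ex_bound_before) (auto intro!: far_Int)
  then obtain h where h: "\<And>a. a \<in> K \<Longrightarrow> h a \<in> K \<and> U a \<subseteq> U (h a) \<and> (\<Union>b\<in>insert a (before a). A a \<inter> B b) \<subseteq> U (h a)"
    by metis
  then have hK: "\<And>a. a \<in> K \<Longrightarrow> h a \<in> K"
    by blast
  obtain M where M': "\<forall>a\<in>K. clopenin X (M a) \<and> x \<notin> M a \<and> A a \<inter> U (h a) \<subseteq> M a"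
    and tame_W: "tame (\<Union>a\<in>K. A a - M a)"
    by (rule ex_tame_thinning[of A h, OF A hK])
  note M = M'[rule_format]
  \<comment> \<open>The first part is far because it lies in a tame union and in a single
    \<open>U c\<close>; the second is far by tameness of \<open>B b\<close>, and its removal makes
    the trimmed \<open>B b\<close> locally small.\<close>
  define N where "N b = ((\<Union>a\<in>K. A a - M a) \<inter> (\<Union>a\<in>insert b (before b). A a \<inter> B b)) \<union> (B b \<inter> U b)" for b
  have "\<exists>m\<in>K. N b \<subseteq> C m"
    if b: "b \<in> K" for b
  proof -
    have "\<exists>c\<in>K. U b \<subseteq> U c \<and> (\<Union>a\<in>insert b (before b). A a \<inter> B b) \<subseteq> U c"
      using b before_in by (intro ex_bound_before) (auto intro!: far_Int)
    then obtain c where c: "c \<in> K" "(\<Union>a\<in>insert b (before b). A a \<inter> B b) \<subseteq> U c"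
      by blast
    have "far ((\<Union>a\<in>K. A a - M a) \<inter> U c)"
      by (rule tameD[OF tame_W c(1)])
    moreover have "far (B b \<inter> U b)"
      using B[OF b] tameD b by simp
    ultimately have "far (((\<Union>a\<in>K. A a - M a) \<inter> U c) \<union> (B b \<inter> U b))"
      by (rule far_Un)
    then have "far (N b)"
      by (rule far_subset) (use c(2) N_def in blast)
    then show ?thesis
      by (simp add: far_def)
  qed
  then obtain m where m1: "\<And>b. b \<in> K \<Longrightarrow> m b \<in> K"
    and m2: "\<And>b. b \<in> K \<Longrightarrow> N b \<subseteq> C (m b)"
    by metis
  note m = m1 m2[unfolded N_def]
  obtain E where E: "clopenin Y E" "\<forall>a\<in>K. A a - M a \<subseteq> E" "\<forall>b\<in>K. E \<inter> (B b - C (m b)) = {}"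
  proof (rule separate_locally_small[of K "\<lambda>a. A a - M a" K "\<lambda>b. B b - C (m b)"])
    show "clopenin Y (A a - M a)" if "a \<in> K" for a
      using A[OF that] M[OF that] clopenin_Y_if_clopenin by (intro clopenin_Diff) auto
    show "clopenin Y (B b - C (m b))" if "b \<in> K" for b
      using B[OF that] C[OF m(1)[OF that]] clopenin_Y_if_clopenin by (intro clopenin_Diff) auto
    show "{i \<in> K. (A i - M i) \<inter> C a \<noteq> {}} \<prec> K" if "a \<in> K" for a
    proof (rule small_subset[OF small_insert_before])
      have "(A i - M i) \<inter> C a = {}" if "i \<in> K" "a \<in> before i" for i
        using M[OF that(1)] h[OF that(1)] C_subset_U[OF that(2)] by blast
      then show "{i \<in> K. (A i - M i) \<inter> C a \<noteq> {}} \<subseteq> insert a (before a)"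
        using before_or_le that by blast
    qed
    show "{j \<in> K. (B j - C (m j)) \<inter> C a \<noteq> {}} \<prec> K" if "a \<in> K" for a
    proof (rule small_subset[OF small_insert_before])
      have "(B j - C (m j)) \<inter> C a = {}" if "j \<in> K" "a \<in> before j" for j
        using m(2)[OF that(1)] C_subset_U[OF that(2)] by blast
      then show "{j \<in> K. (B j - C (m j)) \<inter> C a \<noteq> {}} \<subseteq> insert a (before a)"
        using before_or_le that by blast
    qed
    show "(A a - M a) \<inter> (B b - C (m b)) = {}" if "a \<in> K" "b \<in> K" for a b
    proof (cases "a \<in> insert b (before b)")
      case True
      then show ?thesis
        using m(2)[OF that(2)] that(1) by blast
    next
      case False
      then have "A a \<inter> B b \<subseteq> U (h a)"
        using before_or_le[OF that] h[OF that(1)] by blast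
      then show ?thesis
        using M[OF that(1)] by blast
    qed
  qed (rule that)
  have "far (A a - E)" if "a \<in> K" for a
  proof (rule far_subset)
    show "far (M a)"
      using M[OF that] far_clopenin by blast
    show "A a - E \<subseteq> M a"
      using E(2) that by blast
  qed
  moreover have "far (B b \<inter> E)" if "b \<in> K" for b
  proof (rule far_subset[OF far_C[OF m(1)[OF that]]])
    show "B b \<inter> E \<subseteq> C (m b)"
      using E(3) that by blast
  qed
  ultimately show thesis
    using that[OF E(1)] by blast
qed

text \<open>If some member of the two families is not tame then its complement is, and everything may be
  intersected with this complement.\<close>

lemma separate_families:
  assumes A: "\<And>a. a \<in> K \<Longrightarrow> clopenin Y (A a)" and B: "\<And>a. a \<in> K \<Longrightarrow> clopenin Y (B a)"
    and far_Int: "\<And>a b. \<lbrakk>a \<in> K; b \<in> K\<rbrakk> \<Longrightarrow> far (A a \<inter> B b)"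
  obtains E where "clopenin Y E" "\<forall>a\<in>K. far (A a - E)" "\<forall>b\<in>K. far (B b \<inter> E)"
proof -
  have relative: "\<exists>E. clopenin Y E \<and> E \<subseteq> topspace Y - V \<and> (\<forall>a\<in>K. far (A a - V - E)) \<and> (\<forall>b\<in>K. far (B b \<inter> E))"
    if V: "clopenin Y V" "\<not> tame V" for V
  proof -
    let ?Z = "topspace Y - V"
    have Z1: "clopenin Y ?Z"
      by (rule clopenin_Diff[OF clopenin_topspace V(1)])
    have "tame V \<or> tame ?Z"
      by (rule tame_or_tame_if_disjoint[OF V(1) Z1]) simp
    then have Z: "clopenin Y ?Z" "tame ?Z"
      using Z1 V(2) by simp_all
    obtain E where E: "clopenin Y E" "\<forall>a\<in>K. far (A a \<inter> ?Z - E)" "\<forall>b\<in>K. far (B b \<inter> ?Z \<inter> E)"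
    proof (rule separate_tame_families[of "\<lambda>a. A a \<inter> ?Z" "\<lambda>b. B b \<inter> ?Z"])
      show "clopenin Y (A a \<inter> ?Z) \<and> tame (A a \<inter> ?Z)" if "a \<in> K" for a
        by (rule conjI[OF clopenin_Int[OF A[OF that] Z(1)] tame_subset[OF Z(2) Int_lower2]])
      show "clopenin Y (B a \<inter> ?Z) \<and> tame (B a \<inter> ?Z)" if "a \<in> K" for a
        by (rule conjI[OF clopenin_Int[OF B[OF that] Z(1)] tame_subset[OF Z(2) Int_lower2]])
      show "far (A a \<inter> ?Z \<inter> (B b \<inter> ?Z))" if "a \<in> K" "b \<in> K" for a b
        by (rule far_subset[OF far_Int[OF that]]) blast
    qed (rule that)
    show ?thesis
    proof (intro exI[of _ "E \<inter> ?Z"] conjI ballI)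
      show "clopenin Y (E \<inter> ?Z)"
        by (rule clopenin_Int[OF E(1) Z(1)])
      show "far (A a - V - E \<inter> ?Z)" if "a \<in> K" for a
        using E(2)[rule_format, OF that] clopenin_subset[OF A[OF that]] by (elim far_subset) blast
      show "far (B b \<inter> (E \<inter> ?Z))" if "b \<in> K" for b
        using E(3)[rule_format, OF that] by (elim far_subset) blast
    qed blast
  qed
  consider "\<forall>a\<in>K. tame (A a) \<and> tame (B a)" | a where "a \<in> K" "\<not> tame (A a)" | b where "b \<in> K" "\<not> tame (B b)"
    by blast
  then show thesis
  proof cases
    case 1
    show thesis
    proof (rule separate_tame_families[of A B])
      show "clopenin Y (A a) \<and> tame (A a)" "clopenin Y (B a) \<and> tame (B a)" if "a \<in> K" for a
        using A[OF that] B[OF that] 1 that by simp_all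
    qed (fact far_Int that)+
  next
    case (2 a0)
    obtain E where E: "clopenin Y E" "\<forall>a\<in>K. far (A a - A a0 - E)" "\<forall>b\<in>K. far (B b \<inter> E)"
      using relative[OF A[OF 2(1)] 2(2)] by blast
    \<comment> \<open>\<open>A a0\<close> goes entirely into the separating set, since it meets
      every \<open>B b\<close> in a far set. In the remaining case \<open>B b0\<close> is left out
      entirely for the same reason.\<close>
    show thesis
    proof (rule that[of "A a0 \<union> E"])
      show "clopenin Y (A a0 \<union> E)"
        by (rule clopenin_Un[OF A[OF 2(1)] E(1)])
      have "A a - (A a0 \<union> E) = A a - A a0 - E" for a
        by blast
      then show "\<forall>a\<in>K. far (A a - (A a0 \<union> E))"
        using E(2) by simp
      have "B b \<inter> (A a0 \<union> E) = (A a0 \<inter> B b) \<union> (B b \<inter> E)" for b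
        by blast
      then show "\<forall>b\<in>K. far (B b \<inter> (A a0 \<union> E))"
        using E(3) far_Int[OF 2(1)] by (simp add: far_Un)
    qed
  next
    case (3 b0)
    obtain E where E: "clopenin Y E" "E \<subseteq> topspace Y - B b0" "\<forall>a\<in>K. far (A a - B b0 - E)" "\<forall>b\<in>K. far (B b \<inter> E)"
      using relative[OF B[OF 3(1)] 3(2)] by blast
    show thesis
    proof (rule that[OF E(1) _ E(4)], rule ballI)
      fix a assume a: "a \<in> K"
      have "far ((A a - B b0 - E) \<union> (A a \<inter> B b0))"
        using E(3) a far_Int[OF a 3(1)] by (intro far_Un) auto
      then show "far (A a - E)"
        by (rule far_subset) blast
    qed
  qed
qed

end

section \<open>The remainder\<close>

locale stone_cech_punctured = punctured K X x C
  for K :: "'k set" and X :: "'a topology" and x :: 'a and C :: "'k \<Rightarrow> 'a set" +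
  fixes B :: "'b topology" and e :: "'a \<Rightarrow> 'b"
  assumes stone_cech: "stone_cech Y B e"
begin

definition R :: "'b topology" where
  "R = remainder Y B e"

definition cl :: "'a set \<Rightarrow> 'b set" where
  "cl D = B closure_of (e ` D)"

definition star :: "'a set \<Rightarrow> 'b set" where
  "star D = cl D - e ` topspace Y"

lemma compact_B: "compact_space B" and Hausdorff_B: "Hausdorff_space B" and embedding_e: "embedding_map Y B e"
  and dense_e: "B closure_of (e ` topspace Y) = topspace B"
  using stone_cech by (simp_all only: stone_cech_def)

lemma homeomorphic_e: "homeomorphic_map Y (subtopology B (e ` topspace Y)) e"
  using embedding_e by (simp only: embedding_map_def)

lemma continuous_e: "continuous_map Y B e"
  using homeomorphic_imp_continuous_map[OF homeomorphic_e] continuous_map_in_subtopology by blast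

lemma inj_e: "inj_on e (topspace Y)"
  using homeomorphic_imp_injective_map[OF homeomorphic_e] .

lemma e_in: "y \<in> topspace Y \<Longrightarrow> e y \<in> topspace B"
  using continuous_map_image_subset_topspace[OF continuous_e] by blast

lemma extension:
  assumes "continuous_map Y euclideanreal f" "\<And>y. y \<in> topspace Y \<Longrightarrow> \<bar>f y\<bar> \<le> M"
  obtains g where "continuous_map B euclideanreal g" "\<forall>y\<in>topspace Y. g (e y) = f y"
proof -
  have f: "continuous_map Y euclideanreal f \<and> (\<exists>M. \<forall>y\<in>topspace Y. \<bar>f y\<bar> \<le> M)"
    using assms by blast
  have ext: "\<forall>f. continuous_map Y euclideanreal f \<and> (\<exists>M. \<forall>y\<in>topspace Y. \<bar>f y\<bar> \<le> M)
        \<longrightarrow> (\<exists>g. continuous_map B euclideanreal g \<and> (\<forall>y\<in>topspace Y. g (e y) = f y))"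
    using stone_cech unfolding stone_cech_def by (elim conjE)
  show thesis
    by (rule exE[OF mp[OF spec[OF ext] f]]) (erule conjE, rule that)
qed

lemma closedin_preimage_B:
  assumes "continuous_map B euclideanreal g" "closed S"
  shows "closedin B {b \<in> topspace B. g b \<in> S}"
  by (rule closedin_continuous_map_preimage[OF assms(1)]) (simp only: closed_closedin[symmetric] assms(2))

lemma topspace_B_subset_closed:
  assumes "closedin B T" "e ` topspace Y \<subseteq> T"
  shows "topspace B \<subseteq> T"
  using closure_of_minimal[OF assms(2,1)] dense_e by simp

text \<open>The indicator of \<open>D\<close> extends to \<open>B\<close>, and density of the image
  of \<open>Y\<close> confines the extension to the values \<open>0\<close> and \<open>1\<close>.
  Its level \<open>1\<close> is clopen and coincides with the closure.\<close>

lemma cl_props: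
  assumes D: "clopenin Y D"
  shows "clopenin B (cl D)" "cl D \<inter> e ` topspace Y = e ` D"
proof -
  have sub: "D \<subseteq> topspace Y"
    by (rule clopenin_subset[OF D])
  obtain g where g: "continuous_map B euclideanreal g" "\<forall>y\<in>topspace Y. g (e y) = indicat_real D y"
    by (rule extension[OF continuous_map_indicat_clopenin[OF D], of 1]) (simp add: indicator_def)
  have "topspace B \<subseteq> {b \<in> topspace B. g b \<in> {0, 1}}"
    by (rule topspace_B_subset_closed[OF closedin_preimage_B[OF g(1)]])
      (use g(2) e_in in \<open>auto simp: indicator_def split: if_splits\<close>)
  then have g01: "g b = 0 \<or> g b = 1" if "b \<in> topspace B" for b
    using that by blast
  define G where "G = {b \<in> topspace B. g b \<in> {1}}"
  have "topspace B - G = {b \<in> topspace B. g b \<in> {0}}"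
    unfolding G_def using g01 by force
  then have "closedin B (topspace B - G)" "closedin B G"
    using closedin_preimage_B[OF g(1), of "{0}"] closedin_preimage_B[OF g(1), of "{1}"] by (simp_all add: G_def)
  then have G: "clopenin B G"
    by (simp add: clopenin_def openin_closedin_eq G_def)
  have GY: "G \<inter> e ` topspace Y = e ` D"
  proof -
    have "g (e y) = 1 \<longleftrightarrow> y \<in> D" if "y \<in> topspace Y" for y
      using g(2) that by (auto simp: indicator_def)
    then show ?thesis
      unfolding G_def using e_in sub by blast
  qed
  have "cl D \<subseteq> G"
    unfolding cl_def using GY by (intro clopenin_closure_subset[OF G]) blast
  moreover have "G \<inter> topspace B \<subseteq> cl D"
    unfolding cl_def GY[symmetric] using openin_Int_closure_of_subset[of B G "e ` topspace Y"] G dense_e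
    by (simp add: clopenin_def)
  ultimately have "cl D = G"
    by (auto simp: G_def)
  then show "clopenin B (cl D)" "cl D \<inter> e ` topspace Y = e ` D"
    using G GY by simp_all
qed

lemma cl_Un: "cl (D \<union> D') = cl D \<union> cl D'"
  by (simp add: cl_def image_Un)

lemma cl_topspace: "cl (topspace Y) = topspace B"
  unfolding cl_def by (rule dense_e)

lemma cl_Diff:
  assumes D: "clopenin Y D"
  shows "cl (topspace Y - D) = topspace B - cl D"
proof -
  have sub: "D \<subseteq> topspace Y"
    by (rule clopenin_subset[OF D])
  have "e ` (topspace Y - D) \<inter> e ` D = {}"
    using inj_e sub unfolding inj_on_def by blast
  then have "e ` (topspace Y - D) \<inter> cl D = {}"
    using cl_props(2)[OF D] by blast
  then have "cl (topspace Y - D) \<inter> cl D = {}"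
    unfolding cl_def[of "topspace Y - D"] by (rule clopenin_closure_disjoint[OF cl_props(1)[OF D]])
  moreover have "cl (topspace Y - D) \<union> cl D = topspace B"
    using cl_Un[of "topspace Y - D" D] sub cl_topspace by (simp add: Un_absorb2)
  ultimately show ?thesis
    by blast
qed

lemma topspace_R: "topspace R = topspace B - e ` topspace Y"
  unfolding R_def remainder_def by auto

lemma star_subset: "star D \<subseteq> topspace R"
  unfolding star_def topspace_R cl_def using closure_of_subset_topspace by fast

lemma star_topspace: "star (topspace Y) = topspace R"
  unfolding star_def topspace_R cl_topspace ..

lemma star_Un: "star (D \<union> D') = star D \<union> star D'"
  unfolding star_def cl_Un by blast

lemma star_Diff_topspace: "clopenin Y D \<Longrightarrow> star (topspace Y - D) = topspace R - star D"
  unfolding star_def topspace_R by (simp only: cl_Diff) blast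

lemma star_Int:
  assumes "clopenin Y D" "clopenin Y D'"
  shows "star (D \<inter> D') = star D \<inter> star D'"
proof -
  have eq: "D \<inter> D' = topspace Y - ((topspace Y - D) \<union> (topspace Y - D'))"
    using clopenin_subset[OF assms(1)] by blast
  have "clopenin Y ((topspace Y - D) \<union> (topspace Y - D'))"
    using assms by (intro clopenin_Un clopenin_Diff clopenin_topspace)
  then have "star (D \<inter> D') = topspace R - ((topspace R - star D) \<union> (topspace R - star D'))"
    by (subst eq) (simp only: star_Diff_topspace star_Un assms)
  then show ?thesis
    using star_subset[of D] by blast
qed

lemma star_Diff:
  assumes "clopenin Y D" "clopenin Y D'"
  shows "star (D - D') = star D - star D'"
proof -
  have "D - D' = D \<inter> (topspace Y - D')"
    using clopenin_subset[OF assms(1)] by blast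
  then have "star (D - D') = star D \<inter> (topspace R - star D')"
    by (simp only: star_Int[OF assms(1) clopenin_Diff[OF clopenin_topspace assms(2)]] star_Diff_topspace[OF assms(2)])
  then show ?thesis
    using star_subset[of D] by blast
qed

text \<open>Both sides say that \<open>D\<close> is compact: its closure in \<open>B\<close> adds no
  point, respectively it lies in a compact open subset of \<open>Y\<close>.\<close>

lemma star_empty_iff:
  assumes D: "clopenin Y D"
  shows "star D = {} \<longleftrightarrow> far D"
proof
  assume "star D = {}"
  then have "cl D = e ` D"
    using cl_props(2)[OF D] unfolding star_def by blast
  then have "closedin B (e ` D)"
    using cl_props(1)[OF D] by (simp only: clopenin_def)
  then have "compactin B (e ` D)"
    by (rule closedin_compact_space[OF compact_B])
  moreover have sub: "D \<subseteq> topspace Y"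
    by (rule clopenin_subset[OF D])
  ultimately have "compactin (subtopology B (e ` topspace Y)) (e ` D)"
    unfolding compactin_subtopology using image_mono[OF sub] by blast
  then have "compactin Y D"
    using homeomorphic_map_compactness[OF homeomorphic_e sub] by (simp only:)
  then have "compactin X D"
    by (simp only: compactin_subtopology)
  then have "clopenin X D"
    using compactin_imp_closedin[OF Hausdorff] D openin_X_if_openin_Y by (simp only: clopenin_def)
  then show "far D"
    using sub by (intro far_clopenin) auto
next
  assume far: "far D"
  then have "clopenin X D"
    using clopenin_X_iff_far[OF D] by (simp only:)
  then have "compactin X D"
    using closedin_compact_space[OF compact] by (simp only: clopenin_def)
  then have "compactin Y D"
    using clopenin_subset[OF D] by (simp add: compactin_subtopology)
  then have "compactin B (e ` D)"
    by (rule image_compactin[OF _ continuous_e])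
  then have "cl D = e ` D"
    using compactin_imp_closedin[OF Hausdorff_B] by (simp only: cl_def closure_of_closedin)
  then show "star D = {}"
    using clopenin_subset[OF D] unfolding star_def by blast
qed

text \<open>Local compactness of \<open>Y\<close>: the compact images of the \<open>C a\<close>
  equal their closures and so are open in \<open>B\<close>. Consequently the remainder is
  compact.\<close>

lemma openin_e: "openin B (e ` topspace Y)"
proof -
  have "openin B (e ` C a)" if a: "a \<in> K" for a
  proof -
    have clY: "clopenin Y (C a)"
      using C[OF a] clopenin_Y_if_clopenin by simp
    have "star (C a) = {}"
      using star_empty_iff[OF clY] far_C[OF a] by simp
    then have "cl (C a) = e ` C a"
      using cl_props(2)[OF clY] unfolding star_def by blast
    then show ?thesis
      using cl_props(1)[OF clY] by (simp add: clopenin_def)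
  qed
  then have "openin B (\<Union>a\<in>K. e ` C a)"
    by blast
  moreover have "(\<Union>a\<in>K. e ` C a) = e ` topspace Y"
    using ex_C C_subset by blast
  ultimately show ?thesis
    by (simp only:)
qed

lemma compact_R: "compact_space R"
proof -
  have "closedin B (topspace B - e ` topspace Y)"
    using openin_e by blast
  then show ?thesis
    unfolding R_def remainder_def by (intro compact_space_subtopology closedin_compact_space[OF compact_B])
qed

lemma Hausdorff_R: "Hausdorff_space R"
  unfolding R_def remainder_def by (rule Hausdorff_space_subtopology[OF Hausdorff_B])

lemma clopenin_star:
  assumes D: "clopenin Y D"
  shows "clopenin R (star D)"
proof -
  have "star D = cl D \<inter> (topspace B - e ` topspace Y)"
    using clopenin_subset[OF cl_props(1)[OF D]] unfolding star_def by blast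
  then show ?thesis
    using cl_props(1)[OF D] unfolding R_def remainder_def clopenin_def
    by (auto simp: openin_subtopology closedin_subtopology)
qed

text \<open>This is where strong zero-dimensionality of \<open>Y\<close> is used: a function on
  \<open>B\<close> that separates \<open>r\<close> from the complement of a neighbourhood is
  restricted to \<open>Y\<close>, and a clopen set between two of its level sets provides the
  trace.\<close>

lemma star_base:
  assumes "openin R W" "r \<in> W"
  obtains D where "clopenin Y D" "r \<in> star D" "star D \<subseteq> W"
proof -
  obtain V where V: "openin B V" "W = V \<inter> (topspace B - e ` topspace Y)"
    using assms(1) unfolding R_def remainder_def openin_subtopology by blast
  have "completely_regular_space B"
    using compact_B Hausdorff_B compact_Hausdorff_or_regular_imp_normal_space normal_imp_completely_regular_space by blast
  moreover have "closedin B (topspace B - V)" "r \<in> topspace B - (topspace B - V)"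
    using V assms(2) by auto
  ultimately obtain f where f: "f r = 0" "f ` (topspace B - V) \<subseteq> {1}" and cont: "continuous_map B euclideanreal f"
    unfolding completely_regular_space_alt by metis
  have "continuous_map Y euclideanreal (f \<circ> e)"
    using cont by (rule continuous_map_compose[OF continuous_e])
  then obtain E where E: "clopenin Y E" "{y \<in> topspace Y. (f \<circ> e) y \<le> 1/3} \<subseteq> E" 
      "E \<inter> {y \<in> topspace Y. 2/3 \<le> (f \<circ> e) y} = {}"
    by (rule separate_level_sets)
  have r: "r \<in> topspace B" "r \<notin> e ` topspace Y"
    using V assms(2) by auto
  \<comment> \<open>By density \<open>B\<close> is covered by the closed sets
    \<open>f \<ge> 1/3\<close> and \<open>cl E\<close>; as \<open>f r = 0\<close>, the point
    \<open>r\<close> lies in the latter.\<close>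
  have "topspace B \<subseteq> {b \<in> topspace B. f b \<in> {1/3..}} \<union> cl E"
  proof (rule topspace_B_subset_closed)
    show "closedin B ({b \<in> topspace B. f b \<in> {1/3..}} \<union> cl E)"
      using closedin_preimage_B[OF cont closed_atLeast] cl_props(1)[OF E(1)] by (simp only: closedin_Un clopenin_def)
    have "e y \<in> cl E" if "y \<in> topspace Y" "f (e y) < 1/3" for y
    proof -
      have "y \<in> E"
        using E(2) that by (auto simp: subset_iff)
      then show ?thesis
        using cl_props(2)[OF E(1)] by blast
    qed
    then show "e ` topspace Y \<subseteq> {b \<in> topspace B. f b \<in> {1/3..}} \<union> cl E"
      using e_in by force
  qed
  then have "r \<in> star E"
    using r f(1) unfolding star_def by auto
  moreover have "cl E \<subseteq> {b \<in> topspace B. f b \<in> {..2/3}}"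
    unfolding cl_def
  proof (rule closure_of_minimal)
    show "closedin B {b \<in> topspace B. f b \<in> {..2/3}}"
      by (rule closedin_preimage_B[OF cont closed_atMost])
    show "e ` E \<subseteq> {b \<in> topspace B. f b \<in> {..2/3}}"
      using E(3) clopenin_subset[OF E(1)] e_in by force
  qed
  then have "star E \<subseteq> W"
    using f(2) unfolding V(2) star_def by force
  ultimately show thesis
    by (rule that[OF E(1)])
qed

lemma zero_dim_R: "zero_dim R"
  unfolding zero_dim_def
proof (intro allI impI, elim conjE)
  fix W r assume "openin R W" "r \<in> W"
  then obtain D where "clopenin Y D" "r \<in> star D" "star D \<subseteq> W"
    by (rule star_base)
  then show "\<exists>G. clopenin R G \<and> r \<in> G \<and> G \<subseteq> W"
    using clopenin_star by blast
qed

lemma clopenin_R_is_star: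
  assumes G: "clopenin R G"
  obtains D where "clopenin Y D" "G = star D"
proof -
  define \<D> where "\<D> = {D. clopenin Y D \<and> star D \<subseteq> G}"
  have op: "openin R V" if "V \<in> star ` \<D>" for V
    using that clopenin_star by (auto simp: \<D>_def clopenin_def)
  have cov: "G \<subseteq> \<Union>(star ` \<D>)"
  proof
    fix r assume "r \<in> G"
    moreover have "openin R G"
      using G by (simp add: clopenin_def)
    ultimately obtain D where "clopenin Y D" "r \<in> star D" "star D \<subseteq> G"
      using star_base by blast
    then show "r \<in> \<Union>(star ` \<D>)"
      by (auto simp: \<D>_def)
  qed
  have cpt: "compactin R G"
    using G by (intro closedin_compact_space[OF compact_R]) (simp add: clopenin_def)
  have "\<exists>\<F>. finite \<F> \<and> \<F> \<subseteq> star ` \<D> \<and> G \<subseteq> \<Union>\<F>"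
    by (rule compactinD[OF cpt op cov])
  then obtain \<F> where "finite \<F>" "\<F> \<subseteq> star ` \<D>" "G \<subseteq> \<Union>\<F>"
    by (elim exE conjE)
  then obtain \<E> where \<E>: "\<E> \<subseteq> \<D>" "finite \<E>" "G \<subseteq> \<Union>(star ` \<E>)"
    using finite_subset_image[of \<F> star \<D>] by blast
  have "star (\<Union>\<E>) = \<Union>(star ` \<E>)"
    using \<E>(2)
  proof (induction rule: finite_induct)
    case empty
    show ?case
      by (simp add: star_def cl_def)
  next
    case (insert D \<E>)
    then show ?case
      by (simp add: star_Un)
  qed
  moreover have "\<Union>(star ` \<E>) \<subseteq> G" and clE: "clopenin Y (\<Union>\<E>)"
    using \<E>(1,2) by (auto simp: \<D>_def intro: clopenin_Union)
  ultimately have "G = star (\<Union>\<E>)"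
    using \<E>(3) by blast
  then show thesis
    by (rule that[OF clE])
qed

section \<open>The Parovicenko properties and the weight of the remainder\<close>

lemma not_isolated_R: "\<not> isolated_point R r"
proof
  assume "isolated_point R r"
  then obtain D where D: "clopenin Y D" "r \<in> star D" "star D \<subseteq> {r}"
    using star_base[of "{r}" r] unfolding isolated_point_def by blast
  then have "\<not> far D"
    using star_empty_iff[OF D(1)] by blast
  then obtain E where E: "clopenin Y E" "\<not> far (D \<inter> E)" "\<not> far (D - E)"
    using ex_split[OF D(1)] by blast
  have "star (D \<inter> E) \<noteq> {}" "star (D - E) \<noteq> {}"
    using star_empty_iff[OF clopenin_Int[OF D(1) E(1)]] star_empty_iff[OF clopenin_Diff[OF D(1) E(1)]] E(2,3)
    by blast+
  then have "star D \<inter> star E \<noteq> {}" "star D - star E \<noteq> {}"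
    by (simp_all add: star_Int[OF D(1) E(1)] star_Diff[OF D(1) E(1)])
  then show False
    using D(3) by blast
qed

lemma star_subset_if_far_Diff:
  assumes "clopenin Y D" "clopenin Y E" "far (D - E)"
  shows "star D \<subseteq> star E"
  using star_empty_iff[OF clopenin_Diff[OF assms(1,2)]] assms(3) star_Diff[OF assms(1,2)] by blast

text \<open>A point \<open>r\<close> of the intersection lies in all traces
  \<open>star (D a)\<close>, which makes the \<open>D a\<close> centred; the trace of a
  pseudointersection is then a non-empty open subset of the intersection.\<close>

lemma G_space_R: "G_space (Field (cardSuc (card_of K))) R"
  unfolding G_space_def
proof (intro allI impI, elim conjE)
  fix \<U> assume \<U>: "\<forall>V\<in>\<U>. openin R V" "\<U> \<prec> Field (cardSuc (card_of K))" "topspace R \<inter> \<Inter>\<U> \<noteq> {}"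
  then obtain r where r: "r \<in> topspace R" "\<And>V. V \<in> \<U> \<Longrightarrow> r \<in> V"
    by blast
  have "\<U> \<lesssim> K"
    using \<U>(2) by (simp add: lesspoll_Field_cardSuc_iff)
  then obtain f where f: "\<U> \<subseteq> f ` K" "f ` K \<subseteq> insert (topspace R) \<U>"
    by (rule lepoll_enumeration[where d = "topspace R"])
  have exD: "\<exists>D. clopenin Y D \<and> r \<in> star D \<and> star D \<subseteq> f a" if "a \<in> K" for a
  proof -
    have "f a \<in> insert (topspace R) \<U>"
      using f(2) that by blast
    then have "openin R (f a)" "r \<in> f a"
      using \<U>(1) r by auto
    then show ?thesis
      using star_base[of "f a" r] by blast
  qed
  have "\<exists>D. \<forall>a\<in>K. clopenin Y (D a) \<and> r \<in> star (D a) \<and> star (D a) \<subseteq> f a"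
    by (rule bchoice) (rule ballI, rule exD)
  then obtain D where D: "\<And>a. a \<in> K \<Longrightarrow> clopenin Y (D a)" "\<And>a. a \<in> K \<Longrightarrow> r \<in> star (D a)"
      "\<And>a. a \<in> K \<Longrightarrow> star (D a) \<subseteq> f a"
    by blast
  have centered: "\<not> far (topspace Y \<inter> (\<Inter>a\<in>T. D a))" if T: "T \<subseteq> K" "finite T" for T
  proof -
    have "clopenin Y (topspace Y \<inter> (\<Inter>a\<in>T. D a)) \<and> r \<in> star (topspace Y \<inter> (\<Inter>a\<in>T. D a))"
      using T(2,1)
    proof (induction rule: finite_induct)
      case empty
      have "topspace Y \<inter> (\<Inter>a\<in>{}. D a) = topspace Y"
        by simp
      then show ?case
        using r(1) star_topspace clopenin_topspace[of Y] by (simp only:)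
    next
      case (insert a T)
      let ?T = "topspace Y \<inter> (\<Inter>a\<in>T. D a)"
      have IH: "clopenin Y ?T" "r \<in> star ?T" and a: "a \<in> K"
        using insert by auto
      have "topspace Y \<inter> (\<Inter>a\<in>insert a T. D a) = D a \<inter> ?T"
        by blast
      then show ?case
        using clopenin_Int[OF D(1)[OF a] IH(1)] star_Int[OF D(1)[OF a] IH(1)] IH(2) D(2)[OF a] by (simp only: Int_iff)
    qed
    then show ?thesis
      using star_empty_iff by blast
  qed
  obtain E where E: "clopenin Y E" "\<not> far E" "\<And>a. a \<in> K \<Longrightarrow> far (E - D a)"
    using ex_pseudointersection[of D, OF D(1) centered] by blast
  have "star E \<subseteq> f a" if "a \<in> K" for a
    using star_subset_if_far_Diff[OF E(1) D(1)[OF that] E(3)[OF that]] D(3)[OF that] by (rule subset_trans)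
  then have "star E \<subseteq> topspace R \<inter> \<Inter>\<U>"
    using f(1) star_subset by blast
  moreover have "openin R (star E)"
    using clopenin_star[OF E(1)] by (simp only: clopenin_def)
  ultimately have "star E \<subseteq> R interior_of (topspace R \<inter> \<Inter>\<U>)"
    by (rule interior_of_maximal)
  then show "R interior_of (topspace R \<inter> \<Inter>\<U>) \<noteq> {}"
    using star_empty_iff[OF E(1)] E(2) by blast
qed

text \<open>Although \<open>f\<close> is continuous only on \<open>V\<close>, its closed level sets
  within the clopen set \<open>G\<close> are closed in all of \<open>R\<close>, so compactness
  provides a clopen set between them.\<close>

lemma ex_star_between_levels:
  assumes f: "continuous_map (subtopology R V) euclideanreal f" and G: "clopenin R G" "G \<subseteq> V" and "c < d"
  shows "\<exists>A. clopenin Y A \<and> {r \<in> G. d \<le> f r} \<subseteq> star A \<and> star A \<subseteq> {r \<in> G. c < f r}"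
proof -
  have fG: "continuous_map (subtopology R G) euclideanreal f"
    by (rule continuous_map_from_subtopology_mono[OF f G(2)])
  have closed: "closedin R {r \<in> G. f r \<in> S}" if "closed S" for S
  proof -
    have "closedin (subtopology R G) {r \<in> topspace (subtopology R G). f r \<in> S}"
      by (rule closedin_continuous_map_preimage[OF fG]) (simp only: closed_closedin[symmetric] that)
    moreover have "topspace (subtopology R G) = G"
      using clopenin_subset[OF G(1)] by auto
    ultimately have "closedin (subtopology R G) {r \<in> G. f r \<in> S}"
      by (simp only:)
    then show ?thesis
      using closedin_trans_full[of R G] G(1) by (simp only: clopenin_def)
  qed
  have "closedin R {r \<in> G. f r \<in> {d..}}"
    by (rule closed) (rule closed_atLeast)
  moreover have "closedin R ({r \<in> G. f r \<in> {..c}} \<union> (topspace R - G))"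
    using G(1) by (intro closedin_Un[OF closed[OF closed_atMost]] closedin_diff[OF closedin_topspace])
      (simp only: clopenin_def)
  moreover have "{r \<in> G. f r \<in> {d..}} \<inter> ({r \<in> G. f r \<in> {..c}} \<union> (topspace R - G)) = {}"
    using \<open>c < d\<close> by auto
  ultimately obtain H where H: "clopenin R H" "{r \<in> G. f r \<in> {d..}} \<subseteq> H"
      "H \<inter> ({r \<in> G. f r \<in> {..c}} \<union> (topspace R - G)) = {}"
    by (rule compact_zero_dim_separation[OF compact_R zero_dim_R])
  obtain A where A: "clopenin Y A" "H = star A"
    by (rule clopenin_R_is_star[OF H(1)])
  have "H \<subseteq> {r \<in> G. c < f r}"
    using H(3) clopenin_subset[OF H(1)] by force
  then show ?thesis
    using A H(2) by auto
qed

text \<open>On each of the kappa many clopen pieces of \<open>V\<close>, the upper and lower thirds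
  of \<open>f\<close> are enclosed in traces on which \<open>f > 1/2\<close> and
  \<open>f < 1/2\<close>. Opposite traces are disjoint, so the two families are orthogonal, and the
  trace of a separating set is what the series criterion asks for.\<close>

lemma F_space_R: "F_space (Field (cardSuc (card_of K))) R"
  unfolding F_space_def
proof (intro conjI allI impI zero_dim_R, elim conjE)
  fix V assume "openin R V" "type_less R V (Field (cardSuc (card_of K)))"
  then obtain \<C> where \<C>: "\<forall>G\<in>\<C>. clopenin R G" "\<Union>\<C> = V" "\<C> \<prec> Field (cardSuc (card_of K))"
    unfolding type_less_def by blast
  have "\<C> \<lesssim> K"
    using \<C>(3) by (simp add: lesspoll_Field_cardSuc_iff)
  then obtain G where G: "\<C> \<subseteq> G ` K" "G ` K \<subseteq> insert {} \<C>"
    by (rule lepoll_enumeration[where d = "{}"])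
  have G': "clopenin R (G a)" "G a \<subseteq> V" if "a \<in> K" for a
  proof -
    have "G a \<in> insert {} \<C>"
      using G(2) that by blast
    then show "clopenin R (G a)" "G a \<subseteq> V"
      using \<C>(1,2) by auto
  qed
  have V: "V = (\<Union>a\<in>K. G a)"
    using \<C>(2) G by blast
  show "Cstar_embedded R V"
  proof (rule Cstar_embedded_if_clopen_separation)
    show "V \<subseteq> topspace R"
      using \<open>openin R V\<close> by (rule openin_subset)
  next
    fix f
    assume f: "continuous_map (subtopology R V) euclideanreal f"
    have exA: "\<exists>A. clopenin Y A \<and> {r \<in> G a. 2/3 \<le> f r} \<subseteq> star A \<and> star A \<subseteq> {r \<in> G a. 1/2 < f r}" if "a \<in> K" for a
      by (rule ex_star_between_levels[OF f G'[OF that]]) simp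
    have "\<exists>A. \<forall>a\<in>K. clopenin Y (A a) \<and> {r \<in> G a. 2/3 \<le> f r} \<subseteq> star (A a) \<and> star (A a) \<subseteq> {r \<in> G a. 1/2 < f r}"
      by (rule bchoice) (rule ballI, rule exA)
    then obtain A where A: "\<And>a. a \<in> K \<Longrightarrow> clopenin Y (A a)" "\<And>a. a \<in> K \<Longrightarrow> {r \<in> G a. 2/3 \<le> f r} \<subseteq> star (A a)"
        "\<And>a. a \<in> K \<Longrightarrow> star (A a) \<subseteq> {r \<in> G a. 1/2 < f r}"
      by blast
    \<comment> \<open>The lower level sets of \<open>f\<close> are upper level sets of
      \<open>- f\<close>, hence the negated constants.\<close>
    have exB: "\<exists>A. clopenin Y A \<and> {r \<in> G a. - (1/3) \<le> - f r} \<subseteq> star A \<and> star A \<subseteq> {r \<in> G a. - (1/2) < - f r}" if "a \<in> K" for a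
      by (rule ex_star_between_levels[OF continuous_map_minus[OF f] G'[OF that]]) simp
    have "\<exists>B. \<forall>a\<in>K. clopenin Y (B a) \<and> {r \<in> G a. - (1/3) \<le> - f r} \<subseteq> star (B a) \<and> star (B a) \<subseteq> {r \<in> G a. - (1/2) < - f r}"
      by (rule bchoice) (rule ballI, rule exB)
    then obtain B where B: "\<And>a. a \<in> K \<Longrightarrow> clopenin Y (B a)" "\<And>a. a \<in> K \<Longrightarrow> {r \<in> G a. - (1/3) \<le> - f r} \<subseteq> star (B a)"
        "\<And>a. a \<in> K \<Longrightarrow> star (B a) \<subseteq> {r \<in> G a. - (1/2) < - f r}"
      by blast
    have far: "far (A a \<inter> B b)" if "a \<in> K" "b \<in> K" for a b
    proof -
      have "star (A a) \<inter> star (B b) = {}"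
        using A(3)[OF that(1)] B(3)[OF that(2)] by fastforce
      then show ?thesis
        using star_empty_iff[OF clopenin_Int[OF A(1)[OF that(1)] B(1)[OF that(2)]]]
          star_Int[OF A(1)[OF that(1)] B(1)[OF that(2)]] by blast
    qed
    obtain E where E: "clopenin Y E" "\<forall>a\<in>K. far (A a - E)" "\<forall>b\<in>K. far (B b \<inter> E)"
      by (rule separate_families[OF A(1) B(1) far])
    have "star (A a) \<subseteq> star E" if "a \<in> K" for a
      using star_subset_if_far_Diff[OF A(1)[OF that] E(1)] E(2) that by blast
    then have "\<forall>r\<in>V. 2/3 \<le> f r \<longrightarrow> r \<in> star E"
      using A(2) unfolding V by blast
    moreover have "star (B a) \<inter> star E = {}" if "a \<in> K" for a
      using star_empty_iff[OF clopenin_Int[OF B(1)[OF that] E(1)]] star_Int[OF B(1)[OF that] E(1)] E(3) that by simp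
    then have "\<forall>r\<in>V. f r \<le> 1/3 \<longrightarrow> r \<notin> star E"
      using B(2) unfolding V by fastforce
    ultimately show "\<exists>G. clopenin R G \<and> (\<forall>r\<in>V. 2/3 \<le> f r \<longrightarrow> r \<in> G) \<and> (\<forall>r\<in>V. f r \<le> 1/3 \<longrightarrow> r \<notin> G)"
      using clopenin_star[OF E(1)] by blast
  qed
qed

lemma Parovicenko_R: "Parovicenko (Field (cardSuc (card_of K))) R"
  unfolding Parovicenko_def
  using compact_R Hausdorff_R zero_dim_R F_space_R G_space_R not_isolated_R by blast

text \<open>A clopen subset of \<open>Y\<close> is determined by its traces on the
  \<open>C a\<close>. Each trace is again some \<open>C b\<close>, so the set is coded by a binary
  relation on \<open>K\<close>.\<close>

lemma clopens_R_lepoll: "{G. clopenin R G} \<lesssim> Pow K"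
proof -
  have "{G. clopenin R G} \<subseteq> star ` {D. clopenin Y D}"
    using clopenin_R_is_star by blast
  then have "{G. clopenin R G} \<lesssim> {D. clopenin Y D}"
    by (rule subset_image_lepoll)
  moreover have "{D. clopenin Y D} \<lesssim> Pow (K \<times> K)"
    unfolding lepoll_def
  proof (intro exI conjI)
    let ?h = "\<lambda>D. {(a, b) \<in> K \<times> K. D \<inter> C a = C b}"
    show "?h ` {D. clopenin Y D} \<subseteq> Pow (K \<times> K)"
      by blast
    show "inj_on ?h {D. clopenin Y D}"
    proof (rule inj_onI)
      fix D D' assume D: "D \<in> {D. clopenin Y D}" "D' \<in> {D. clopenin Y D}" and eq: "?h D = ?h D'"
      have "D \<inter> C a = D' \<inter> C a" if a: "a \<in> K" for a
      proof -
        have "clopenin X (D \<inter> C a)" "x \<notin> D \<inter> C a"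
          using D(1) C[OF a] clopenin_X_Int by auto
        then obtain b where b: "b \<in> K" "D \<inter> C a = C b"
          using C_surj by blast
        then have "(a, b) \<in> ?h D"
          using a by blast
        then have "(a, b) \<in> ?h D'"
          by (simp only: eq)
        then show ?thesis
          using b by simp
      qed
      moreover have "D = (\<Union>a\<in>K. D \<inter> C a)" "D' = (\<Union>a\<in>K. D' \<inter> C a)"
        using D ex_C clopenin_subset[of Y D] clopenin_subset[of Y D'] by blast+
      ultimately show "D = D'"
        by simp
    qed
  qed
  moreover have "Pow (K \<times> K) \<approx> Pow K"
  proof -
    have "|K \<times> K| =o |K|"
      using infinite_K by (simp add: card_of_Times_same_infinite)
    then obtain h where "bij_betw h (K \<times> K) K"
      using card_of_ordIso by blast
    then show ?thesis
      unfolding eqpoll_def using bij_betw_Pow by blast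
  qed
  ultimately show ?thesis
    by (meson lepoll_trans lepoll_trans2)
qed

lemma lepoll_clopens_R: "Pow K \<lesssim> {G. clopenin R G}"
proof -
  obtain E where E: "\<And>S. S \<subseteq> K \<Longrightarrow> clopenin Y (E S)"
    "\<And>S T. \<lbrakk>S \<subseteq> K; T \<subseteq> K; \<not> S \<subseteq> T\<rbrakk> \<Longrightarrow> \<not> far (E S - E T)"
    using ex_many_clopens by blast
  have "S \<subseteq> T" if "S \<subseteq> K" "T \<subseteq> K" "star (E S) = star (E T)" for S T
  proof (rule ccontr)
    assume "\<not> S \<subseteq> T"
    then have "\<not> far (E S - E T)"
      using E(2) that by blast
    moreover have "star (E S - E T) = {}"
      using star_Diff[OF E(1)[OF that(1)] E(1)[OF that(2)]] that(3) by simp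
    ultimately show False
      using star_empty_iff[OF clopenin_Diff[OF E(1)[OF that(1)] E(1)[OF that(2)]]] by simp
  qed
  then have "inj_on (\<lambda>S. star (E S)) (Pow K)"
    unfolding inj_on_def by blast
  moreover have "(\<lambda>S. star (E S)) ` Pow K \<subseteq> {G. clopenin R G}"
    using E(1) clopenin_star by blast
  ultimately show ?thesis
    unfolding lepoll_def by blast
qed

lemma has_weight_R: "has_weight R (Pow K)"
  unfolding has_weight_def
proof (intro conjI allI impI)
  have "is_base R {G. clopenin R G}"
    unfolding is_base_def
  proof (intro conjI allI impI)
    show "\<forall>G\<in>{G. clopenin R G}. openin R G"
      by (simp add: clopenin_def)
    show "\<exists>\<C>\<subseteq>{G. clopenin R G}. \<Union>\<C> = W" if W: "openin R W" for W
    proof (intro exI[of _ "{G. clopenin R G \<and> G \<subseteq> W}"] conjI)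
      show "\<Union>{G. clopenin R G \<and> G \<subseteq> W} = W"
        using zero_dim_R W unfolding zero_dim_def by blast
    qed blast
  qed
  moreover have "{G. clopenin R G} \<approx> Pow K"
    by (rule lepoll_antisym[OF clopens_R_lepoll lepoll_clopens_R])
  ultimately show "\<exists>\<B>. is_base R \<B> \<and> \<B> \<approx> Pow K"
    by blast
next
  fix \<B> assume "is_base R \<B>"
  \<comment> \<open>The 2^kappa many clopen sets are finite unions of base sets, and an infinite
    base has no more finite subsets than members.\<close>
  then have "Pow K \<lesssim> {\<F>. \<F> \<subseteq> \<B> \<and> finite \<F>}"
    using clopenin_lepoll_finite_subsets_of_base[OF compact_R] lepoll_clopens_R lepoll_trans by blast
  then show "Pow K \<lesssim> \<B>"
    by (rule lepoll_finite_subsets) (simp add: infinite_K finite_Pow_iff)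
qed

end

theorem theorem6p3:
  fixes K :: "'k set" and X :: "'a topology" and x :: 'a
    and B :: "'b topology" and e :: "'a \<Rightarrow> 'b"
  assumes "infinite K" and "kappa_lt_kappa_eq K"
    and "Parovicenko K X" and "has_weight X K"
    and "x \<in> topspace X"
    and "stone_cech (subtopology X (topspace X - {x})) B e"
  shows "Parovicenko (Field (cardSuc (card_of K))) (remainder (subtopology X (topspace X - {x})) B e)
       \<and> has_weight (remainder (subtopology X (topspace X - {x})) B e) (Pow K)"
proof -
  \<comment> \<open>The weight bounds the number of clopen sets of \<open>X\<close>, so those
    missing \<open>x\<close> can be listed along \<open>K\<close>.\<close>
  obtain \<B> where \<B>: "is_base X \<B>" "\<B> \<approx> K"
    using assms(4) unfolding has_weight_def by blast
  have "compact_space X"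
    using assms(3) by (simp add: Parovicenko_def)
  then have "{G. clopenin X G} \<lesssim> {\<F>. \<F> \<subseteq> \<B> \<and> finite \<F>}"
    using \<B>(1) by (rule clopenin_lepoll_finite_subsets_of_base)
  also have "{\<F>. \<F> \<subseteq> \<B> \<and> finite \<F>} \<lesssim> \<B>"
    using assms(1) eqpoll_finite_iff[OF \<B>(2)] by (intro finite_subsets_lepoll) simp
  also note \<B>(2)
  finally have "{G. clopenin X G} \<lesssim> K" .
  moreover have "{G. clopenin X G \<and> x \<notin> G} \<subseteq> {G. clopenin X G}"
    by blast
  ultimately have "{G. clopenin X G \<and> x \<notin> G} \<lesssim> K"
    using lepoll_trans subset_imp_lepoll by blast
  then obtain C where C: "{G. clopenin X G \<and> x \<notin> G} \<subseteq> C ` K" "C ` K \<subseteq> insert {} {G. clopenin X G \<and> x \<notin> G}"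
    by (rule lepoll_enumeration[where d = "{}"])
  \<comment> \<open>The default value \<open>{}\<close> of the enumeration is itself a clopen set
    missing \<open>x\<close>.\<close>
  have "insert {} {G. clopenin X G \<and> x \<notin> G} = {G. clopenin X G \<and> x \<notin> G}"
    by auto
  then have range_C: "C ` K = {G. clopenin X G \<and> x \<notin> G}"
    using C by (simp only: subset_antisym)
  interpret regular_cardinal K
    by (rule regular_cardinal_if_kappa_lt_kappa_eq[OF assms(1,2)])
  interpret stone_cech_punctured K X x C B e
    by unfold_locales (fact assms range_C)+
  show ?thesis
    using Parovicenko_R has_weight_R unfolding R_def by blast
qed

end
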